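(* Let $k\in\{1,\dots,n\}$, $p>1$, $\beta<p-1$, $\alpha>-1$, and assume that either (I) $p\le\alpha+\beta+2$, or (II) $p>\alpha+\beta+2$ and $(p-1)\alpha+\beta\ge0$. Let $c\ge0$ and $f(t)=e^{ct}$ for $t\in\mathbb{R}$. Then the equation $$S_k^{\frac1k}[D(|Du|^{p-2}Du)]=|x|^\alpha|Du|^\beta f(u)\quad\text{in }\mathbb{R}^n$$ admits an entire nontrivial admissible subsolution if and only if $c=0$. Likewise, the equation $$\Pi_k^{\frac{1}{C_n^k}}[D(|Du|^{p-2}Du)]=|x|^\alpha|Du|^\beta f(u)\quad\text{in }\mathbb{R}^n$$ admits an entire nontrivial admissible subsolution if and only if $c=0$. Here subsolutions are taken in $C^2(\mathbb{R}^n)$ in case (I), and in $C^2(\mathbb{R}^n\setminus\{0\})\cap W^{2,\delta}_{loc}(\mathbb{R}^n)$ with $\delta\in\left(1,\frac{p-\beta-1}{p-\alpha-\beta-2}\right)$ in case (II).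
   Context: $C_n^k=\frac{n!}{k!(n-k)!}$. For $\lambda\in\mathbb{R}^n$, $S_k(\lambda)=\sum_{i_1<\cdots<i_k}\prod_{s=1}^k\lambda_{i_s}$, $\Gamma_k=\{\lambda\in\mathbb{R}^n: S_i(\lambda)>0,\ i=1,\dots,k\}$, $\Pi_k(\lambda)=\prod_{i_1<\cdots<i_k}\left(\sum_{s=1}^k\lambda_{i_s}\right)$, and $\mathcal{P}_k=\{\lambda\in\mathbb{R}^n:\sum_{s=1}^k\lambda_{i_s}>0\text{ for all }1\le i_1<\cdots<i_k\le n\}$. For a matrix $M$ with real eigenvalues $\lambda(M)$, $S_k[M]=S_k(\lambda(M))$ and $\Pi_k[M]=\Pi_k(\lambda(M))$; $S_k^{1/k}$ and $\Pi_k^{1/C_n^k}$ are the corresponding roots. $D(|Du|^{p-2}Du)$ is the Jacobian matrix of the vector field $|Du|^{p-2}Du$ (set equal to $0$ where $Du=0$). A function $u$ is admissible in $\Omega$ if for all $x\in\Omega$ the eigenvalues $\lambda(D(|Du|^{p-2}Du))$ belong to $\Gamma_k$ (for the $S_k$ equation), respectively to $\mathcal{P}_k$ (for the $\Pi_k$ equation). An entire admissible subsolution is an admissible function defined on all of $\mathbb{R}^n$ that satisfies the equation with "$=$" replaced by "$\ge$". Admissibility and the inequality are understood pointwise at every $x\ne0$, where $|Du|^{p-2}Du$ is $C^1$ and both sides are defined; in case (II) the field $|Du|^{p-2}Du$ is moreover required to be $C^1$ on all of $\mathbb{R}^n$. *)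

theory Defs
  imports "HOL-Analysis.Analysis"
begin

definition S_sym :: "nat \<Rightarrow> real^'n \<Rightarrow> real" where
  "S_sym k l = (\<Sum>A | card A = k. \<Prod>i\<in>A. l $ i)"

definition Gamma_cone :: "nat \<Rightarrow> (real^'n) set" where
  "Gamma_cone k = {l. \<forall>i\<in>{1..k}. S_sym i l > 0}"

definition Pi_sym :: "nat \<Rightarrow> real^'n \<Rightarrow> real" where
  "Pi_sym k l = (\<Prod>A | card A = k. \<Sum>i\<in>A. l $ i)"

definition P_cone :: "nat \<Rightarrow> (real^'n) set" where
  "P_cone k = {l. \<forall>A. card A = k \<longrightarrow> (\<Sum>i\<in>A. l $ i) > 0}"

text \<open>The entries of \<open>l\<close> are all the eigenvalues of \<open>M\<close>, with algebraic multiplicity: the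
  characteristic polynomial of \<open>M\<close> splits over the reals with these roots.\<close>

definition has_eigenvalues :: "real^'n^'n \<Rightarrow> real^'n \<Rightarrow> bool" where
  "has_eigenvalues M l \<longleftrightarrow> (\<forall>t. det (mat t - M) = (\<Prod>i\<in>UNIV. t - l $ i))"

text \<open>The order of the entries is unspecified; only symmetric functions and symmetric cones are
  applied to this vector. It is arbitrary if \<open>M\<close> has non-real eigenvalues, so every use is guarded
  by the existence of a real eigenvalue vector.\<close>

definition eigenvalues :: "real^'n^'n \<Rightarrow> real^'n" where
  "eigenvalues M = (SOME l. has_eigenvalues M l)"

definition S_mat :: "nat \<Rightarrow> real^'n^'n \<Rightarrow> real" where
  "S_mat k M = S_sym k (eigenvalues M)"

definition Pi_mat :: "nat \<Rightarrow> real^'n^'n \<Rightarrow> real" where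
  "Pi_mat k M = Pi_sym k (eigenvalues M)"

definition partial :: "'n \<Rightarrow> (real^'n \<Rightarrow> real) \<Rightarrow> real^'n \<Rightarrow> real" where
  "partial i u x = frechet_derivative u (at x) (axis i 1)"

definition grad :: "(real^'n \<Rightarrow> real) \<Rightarrow> real^'n \<Rightarrow> real^'n" where
  "grad u x = (\<chi> i. partial i u x)"

definition C1_field_on :: "(real^'n) set \<Rightarrow> (real^'n \<Rightarrow> real^'n) \<Rightarrow> bool" where
  "C1_field_on U F \<longleftrightarrow>
     (\<forall>x\<in>U. F differentiable at x) \<and> continuous_on U (\<lambda>x. jacobian F (at x))"

definition C2_on :: "(real^'n) set \<Rightarrow> (real^'n \<Rightarrow> real) \<Rightarrow> bool" where
  "C2_on U u \<longleftrightarrow> (\<forall>x\<in>U. u differentiable at x) \<and> C1_field_on U (grad u)"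

text \<open>\<open>iter_partial [i\<^sub>1, \<dots>, i\<^sub>m] u\<close> is the iterated partial derivative; a list of indices of
  length \<open>m\<close> plays the role of a multi-index of order \<open>m\<close>.\<close>

fun iter_partial :: "'n list \<Rightarrow> (real^'n \<Rightarrow> real) \<Rightarrow> real^'n \<Rightarrow> real" where
  "iter_partial [] u = u"
| "iter_partial (i # is) u = partial i (iter_partial is u)"

definition test_function :: "(real^'n \<Rightarrow> real) \<Rightarrow> bool" where
  "test_function \<phi> \<longleftrightarrow>
     (\<forall>is x. iter_partial is \<phi> differentiable at x) \<and> compact (closure {x. \<phi> x \<noteq> 0})"

definition Lloc :: "real \<Rightarrow> (real^'n \<Rightarrow> real) \<Rightarrow> bool" where
  "Lloc \<delta> g \<longleftrightarrow> g \<in> borel_measurable lebesgue \<and>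
     (\<forall>K. compact K \<longrightarrow> set_integrable lebesgue K (\<lambda>x. \<bar>g x\<bar> powr \<delta>))"

definition weak_partial :: "'n list \<Rightarrow> (real^'n \<Rightarrow> real) \<Rightarrow> (real^'n \<Rightarrow> real) \<Rightarrow> bool" where
  "weak_partial is u g \<longleftrightarrow> (\<forall>\<phi>. test_function \<phi> \<longrightarrow>
     (LINT x|lebesgue. u x * iter_partial is \<phi> x)
       = (-1) ^ length is * (LINT x|lebesgue. g x * \<phi> x))"

text \<open>The case of the empty list together with \<open>Lloc \<delta> u\<close> says just that \<open>u\<close> is its own weak
  derivative of order 0.\<close>

definition Wloc :: "nat \<Rightarrow> real \<Rightarrow> (real^'n \<Rightarrow> real) \<Rightarrow> bool" where
  "Wloc m \<delta> u \<longleftrightarrow> Lloc \<delta> u \<and>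
     (\<forall>is. length is \<le> m \<longrightarrow> (\<exists>g. Lloc \<delta> g \<and> weak_partial is u g))"

text \<open>The field \<open>|Du|\<^sup>p\<^sup>-\<^sup>2 Du\<close>; it is \<open>0\<close> where \<open>Du = 0\<close>, for every \<open>p\<close>.\<close>

definition p_field :: "real \<Rightarrow> (real^'n \<Rightarrow> real) \<Rightarrow> real^'n \<Rightarrow> real^'n" where
  "p_field p u x = norm (grad u x) powr (p - 2) *\<^sub>R grad u x"

definition D_field :: "real \<Rightarrow> (real^'n \<Rightarrow> real) \<Rightarrow> real^'n \<Rightarrow> real^'n^'n" where
  "D_field p u x = jacobian (p_field p u) (at x)"

text \<open>\<open>t\<^sup>b\<close> for \<open>t \<ge> 0\<close>, with the convention \<open>t\<^sup>0 = 1\<close> also at \<open>t = 0\<close>, where \<open>0 powr 0 = 0\<close>. The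
  factor \<open>|Du|\<^sup>0\<close> is thus absent from the equation.\<close>

definition rpow :: "real \<Rightarrow> real \<Rightarrow> real" where
  "rpow t b = (if b = 0 then 1 else t powr b)"

text \<open>Admissibility with respect to a symmetric cone \<open>K\<close>, pointwise away from the origin.\<close>

definition admissible :: "(real^'n) set \<Rightarrow> real \<Rightarrow> (real^'n \<Rightarrow> real) \<Rightarrow> bool" where
  "admissible K p u \<longleftrightarrow> C1_field_on (- {0}) (p_field p u) \<and>
     (\<forall>x. x \<noteq> 0 \<longrightarrow>
        (\<exists>l. has_eigenvalues (D_field p u x) l) \<and> eigenvalues (D_field p u x) \<in> K)"

text \<open>The inequality \<open>Q[D(|Du|\<^sup>p\<^sup>-\<^sup>2 Du)] \<ge> |x|\<^sup>\<alpha> |Du|\<^sup>\<beta> f(u)\<close> at every \<open>x \<noteq> 0\<close>. The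
  right-hand side is undefined where \<open>Du = 0\<close> if \<open>\<beta> < 0\<close>, and \<open>0 powr \<beta> = 0\<close> must not be used
  there.\<close>

definition satisfies_ge ::
  "(real^'n^'n \<Rightarrow> real) \<Rightarrow> real \<Rightarrow> real \<Rightarrow> real \<Rightarrow> (real \<Rightarrow> real) \<Rightarrow> (real^'n \<Rightarrow> real) \<Rightarrow> bool" where
  "satisfies_ge Q p \<alpha> \<beta> f u \<longleftrightarrow> (\<forall>x. x \<noteq> 0 \<longrightarrow>
     (\<beta> < 0 \<longrightarrow> grad u x \<noteq> 0) \<and>
     Q (D_field p u x) \<ge> norm x powr \<alpha> * rpow (norm (grad u x)) \<beta> * f (u x))"

text \<open>The two regularity classes. In the second one, \<open>Du(0)\<close> is the classical gradient, so that
  the field is a function on the whole space.\<close>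

definition regular_I :: "(real^'n \<Rightarrow> real) \<Rightarrow> bool" where
  "regular_I u \<longleftrightarrow> C2_on UNIV u"

definition regular_II :: "real \<Rightarrow> real \<Rightarrow> (real^'n \<Rightarrow> real) \<Rightarrow> bool" where
  "regular_II p \<delta> u \<longleftrightarrow> C2_on (- {0}) u \<and> Wloc 2 \<delta> u \<and>
     (\<forall>x. u differentiable at x) \<and> C1_field_on UNIV (p_field p u)"

definition regular :: "real \<Rightarrow> real \<Rightarrow> real \<Rightarrow> real \<Rightarrow> (real^'n \<Rightarrow> real) \<Rightarrow> bool" where
  "regular p \<alpha> \<beta> \<delta> u \<longleftrightarrow> (if p \<le> \<alpha> + \<beta> + 2 then regular_I u else regular_II p \<delta> u)"

text \<open>Nontrivial means nonconstant.\<close>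

definition entire_nontrivial_subsolution ::
  "(real^'n) set \<Rightarrow> (real^'n^'n \<Rightarrow> real) \<Rightarrow> real \<Rightarrow> real \<Rightarrow> real \<Rightarrow> real \<Rightarrow> (real \<Rightarrow> real)
     \<Rightarrow> (real^'n \<Rightarrow> real) \<Rightarrow> bool" where
  "entire_nontrivial_subsolution K Q p \<alpha> \<beta> \<delta> f u \<longleftrightarrow>
     regular p \<alpha> \<beta> \<delta> u \<and> \<not> u constant_on UNIV \<and> admissible K p u \<and> satisfies_ge Q p \<alpha> \<beta> f u"

end

theory Submission
  imports Defs
begin

text \<open>For c = 0 the radial power u = A |x|^(g + 1) with g = (\<alpha> + 1) / (p - 1 - \<beta>) is a
  subsolution. Its field |Du|^(p-2) Du is a multiple of |x|^(m-1) x with m = g (p - 1), and the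
  Jacobian of |x|^(m-1) x has the eigenvalues |x|^(m-1), with multiplicity n - 1, and m |x|^(m-1).
  They are positive, and g is chosen such that both sides of the inequality are multiples of the same
  power of |x|; as \<beta> < p - 1, a suitable A makes the left side large enough
  (\<open>radial_power_subsolution\<close>). In case (I) g is at least 1 and u is of class C^2. In case (II) the
  second derivatives blow up like |x|^(g-1), which is locally integrable to the power \<delta>
  (\<open>Wloc_radial_power\<close>), while m is at least 1, so that the field stays C^1.

  For c > 0 there is no admissible subsolution. In \<Gamma>_k and in P_k the two operators are
  bounded by a multiple of the trace of the matrix (\<open>root_S_mat_le_trace\<close>,
  \<open>root_Pi_mat_le_trace\<close>), and the trace of D(|Du|^(p-2) Du) is the p-Laplacian of u. Hence u
  satisfies K \<Delta>_p u \<ge> |x|^\<alpha> |Du|^\<beta> exp (c u) and \<Delta>_p u > 0 away from the origin. It is compared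
  with w(x) = b(\<mu> |x|^2) + L, where b vanishes on (-\<infinity>, 1] and blows up at 2. If u(0) \<ge> L, then u - w
  has a nonnegative maximum. Where w has a nonzero gradient, such a maximum contradicts the
  differential inequality as soon as exp (c L) exceeds a constant times \<mu>^((p - \<beta> + \<alpha>)/2)
  (\<open>radial_touching\<close>, \<open>blow_up_profile\<close>). Where w is flat, it contradicts a strong maximum principle
  (\<open>no_critical_max_on_ball\<close>). So u(0) < L for every such L, and letting \<mu> tend to 0 makes L tend
  to -\<infinity>, because p - \<beta> + \<alpha> > 0.\<close>

section \<open>Eigenvalues, the trace and the two cones\<close>

lemma det_scaleR_matrix:
  fixes A :: "real^'n^'n"
  shows "det (c *\<^sub>R A) = c ^ CARD('n) * det A"
  using det_rows_mul[of "\<lambda>_. c" "\<lambda>i. A $ i"]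
  by (simp add: scaleR_vec_def vector_scalar_mult_def)

text \<open>If \<open>i\<close> is moved, then so is its image, by injectivity. In the expansion of det (1 - s M) this
  leaves a vanishing factor behind whichever entry is differentiated.\<close>

lemma permutation_moves_another:
  assumes "\<pi> permutes UNIV" "\<pi> \<noteq> id"
  shows "\<exists>j. j \<noteq> i \<and> \<pi> j \<noteq> j"
proof -
  obtain a where a: "\<pi> a \<noteq> a" using assms(2) by (auto simp: fun_eq_iff)
  show ?thesis
  proof (cases "a = i")
    case True
    have "\<pi> (\<pi> a) \<noteq> \<pi> a" using a permutes_inj[OF assms(1)] by (auto dest: injD)
    then show ?thesis using a True by blast
  qed (use a in blast)
qed

text \<open>Only the identity permutation contributes: every other one has two off-diagonal factors, both of
  which vanish at s = 0.\<close>

lemma det_perturbed_identity_derivative: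
  fixes M :: "real^'n^'n"
  shows "((\<lambda>s. det (mat 1 - s *\<^sub>R M)) has_real_derivative (- trace M)) (at 0)"
proof -
  let ?e = "\<lambda>i j. (if i = j then 1 else 0 :: real)"
  let ?D = "\<lambda>\<pi>. \<Sum>i\<in>UNIV. (- M $ i $ \<pi> i) * (\<Prod>j\<in>UNIV - {i}. ?e j (\<pi> j))"
  have prods: "((\<lambda>s. \<Prod>i\<in>UNIV. ?e i (\<pi> i) - s * M $ i $ \<pi> i) has_real_derivative ?D \<pi>) (at 0)" for \<pi> :: "'n \<Rightarrow> 'n"
    by (rule DERIV_cong, rule has_field_derivative_prod[where f' = "\<lambda>i. - M $ i $ \<pi> i"])
      (auto intro!: derivative_eq_intros)
  have "((\<lambda>s. \<Sum>\<pi>\<in>{\<pi>. \<pi> permutes (UNIV::'n set)}. of_int (sign \<pi>) * (\<Prod>i\<in>UNIV. ?e i (\<pi> i) - s * M $ i $ \<pi> i))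
      has_real_derivative (\<Sum>\<pi>\<in>{\<pi>. \<pi> permutes (UNIV::'n set)}. of_int (sign \<pi>) * ?D \<pi>)) (at 0)"
    by (intro DERIV_sum DERIV_cmult prods)
  moreover have "(\<lambda>s. det (mat 1 - s *\<^sub>R M)) =
      (\<lambda>s. \<Sum>\<pi>\<in>{\<pi>. \<pi> permutes (UNIV::'n set)}. of_int (sign \<pi>) * (\<Prod>i\<in>UNIV. ?e i (\<pi> i) - s * M $ i $ \<pi> i))"
    by (simp add: det_def mat_def)
  moreover have "(\<Sum>\<pi>\<in>{\<pi>. \<pi> permutes (UNIV::'n set)}. of_int (sign \<pi>) * ?D \<pi>) = of_int (sign (id::'n\<Rightarrow>'n)) * ?D id"
  proof (rule sum.remove[where x = id, THEN trans])
    have "?D \<pi> = 0" if "\<pi> permutes UNIV" "\<pi> \<noteq> id" for \<pi> :: "'n \<Rightarrow> 'n"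
    proof (rule sum.neutral, rule ballI)
      fix i :: 'n
      from permutation_moves_another[OF that] obtain j where "j \<noteq> i" "\<pi> j \<noteq> j" by blast
      then have "(\<Prod>j\<in>UNIV - {i}. ?e j (\<pi> j)) = 0" by (intro prod_zero bexI[of _ j]) auto
      then show "(- M $ i $ \<pi> i) * (\<Prod>j\<in>UNIV - {i}. ?e j (\<pi> j)) = 0" by simp
    qed
    then show "of_int (sign (id::'n\<Rightarrow>'n)) * ?D id +
       (\<Sum>\<pi>\<in>{\<pi>. \<pi> permutes (UNIV::'n set)} - {id}. of_int (sign \<pi>) * ?D \<pi>) = of_int (sign (id::'n\<Rightarrow>'n)) * ?D id"
      by simp
  qed (auto simp: permutes_id)
  moreover have "?D id = - trace M" by (simp add: trace_def sum_negf)
  ultimately show ?thesis by (simp del: id_apply)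
qed

text \<open>The entries of \<open>l\<close> are known only through the characteristic polynomial. Reversing its
  coefficients gives det (1 - s M) = \<Prod>(1 - s l_i), and the coefficients of s agree.\<close>

lemma trace_eq_sum_eigenvalues:
  fixes M :: "real^'n^'n"
  assumes "has_eigenvalues M l"
  shows "trace M = (\<Sum>i\<in>UNIV. l $ i)"
proof -
  \<comment> \<open>For s \<noteq> 0 the characteristic polynomial is evaluated at 1/s; at s = 0 both sides are 1.\<close>
  have eq: "det (mat 1 - s *\<^sub>R M) = (\<Prod>i\<in>UNIV. 1 - s * l $ i)" for s
  proof (cases "s = 0")
    case False
    have "mat 1 - s *\<^sub>R M = s *\<^sub>R (mat (1/s) - M)"
      using False by (simp add: vec_eq_iff mat_def right_diff_distrib)
    then have "det (mat 1 - s *\<^sub>R M) = s ^ CARD('n) * (\<Prod>i\<in>UNIV. 1/s - l $ i)"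
      using assms by (simp add: det_scaleR_matrix has_eigenvalues_def)
    also have "\<dots> = (\<Prod>i\<in>UNIV. s * (1/s - l $ i))"
      by (simp only: prod.distrib prod_constant)
    finally show ?thesis using False by (simp add: right_diff_distrib)
  qed simp
  have "((\<lambda>s. \<Prod>i\<in>UNIV. 1 - s * l $ i) has_real_derivative (- (\<Sum>i\<in>UNIV. l $ i))) (at 0)"
    by (rule DERIV_cong, rule has_field_derivative_prod[where f' = "\<lambda>i. - l $ i"])
      (auto intro!: derivative_eq_intros simp: sum_negf)
  with det_perturbed_identity_derivative[of M] have "- trace M = - (\<Sum>i\<in>UNIV. l $ i)"
    unfolding eq by (rule DERIV_unique)
  then show ?thesis by simp
qed

lemma has_eigenvalues_eigenvalues: "has_eigenvalues M l \<Longrightarrow> has_eigenvalues M (eigenvalues M)"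
  unfolding eigenvalues_def by (rule someI)

text \<open>An off-diagonal pair of indices determines a set of size two, and each such set comes from two
  pairs.\<close>

lemma sum_squared_eq_S_sym:
  fixes l :: "real^'n"
  shows "(\<Sum>i\<in>UNIV. l $ i)\<^sup>2 = (\<Sum>i\<in>UNIV. (l $ i)\<^sup>2) + 2 * S_sym 2 l"
proof -
  let ?P = "{(i::'n,j). i \<noteq> j}"
  have "(\<Sum>i\<in>UNIV. l $ i)\<^sup>2 = (\<Sum>(i,j)\<in>UNIV. l $ i * l $ j)"
    by (simp add: power2_eq_square sum_product sum.cartesian_product)
  also have "UNIV = (\<lambda>i. (i,i)) ` UNIV \<union> ?P" by auto
  also have "(\<Sum>(i,j)\<in>(\<lambda>i. (i,i)) ` UNIV \<union> ?P. l $ i * l $ j)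
      = (\<Sum>(i,j)\<in>(\<lambda>i. (i,i)) ` UNIV. l $ i * l $ j) + (\<Sum>(i,j)\<in>?P. l $ i * l $ j)"
    by (rule sum.union_disjoint) auto
  also have "(\<Sum>(i,j)\<in>(\<lambda>i. (i,i)) ` UNIV. l $ i * l $ j) = (\<Sum>i\<in>UNIV. (l $ i)\<^sup>2)"
    by (subst sum.reindex) (auto simp: inj_on_def power2_eq_square)
  also have "(\<Sum>(i,j)\<in>?P. l $ i * l $ j) =
      (\<Sum>A | card A = 2. \<Sum>q | q \<in> ?P \<and> {fst q, snd q} = A. (case q of (i,j) \<Rightarrow> l $ i * l $ j))"
    by (rule sum.group[symmetric]) auto
  also have "\<dots> = (\<Sum>A | card A = (2::nat). 2 * (\<Prod>i\<in>A. l $ i))"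
  proof (rule sum.cong)
    fix A :: "'n set" assume "A \<in> {A. card A = 2}"
    then obtain a b where ab: "A = {a,b}" "a \<noteq> b" by (auto simp: card_2_iff)
    then have "{q. q \<in> ?P \<and> {fst q, snd q} = A} = {(a,b),(b,a)}"
      by (auto simp: doubleton_eq_iff)
    then show "(\<Sum>q | q \<in> ?P \<and> {fst q, snd q} = A. (case q of (i,j) \<Rightarrow> l $ i * l $ j)) = 2 * (\<Prod>i\<in>A. l $ i)"
      using ab by simp
  qed simp
  finally show ?thesis by (simp add: S_sym_def sum_distrib_left)
qed

lemma S_sym_1: "S_sym 1 l = (\<Sum>i\<in>UNIV. l $ i)"
proof -
  have "{A::'a set. card A = 1} = (\<lambda>i. {i}) ` UNIV" by (auto simp: card_1_singleton_iff)
  then show ?thesis unfolding S_sym_def by (simp add: sum.reindex)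
qed

text \<open>A crude Maclaurin inequality. If k is at least 2, then S_2 > 0 bounds the sum of the squares
  S_1^2 - 2 S_2 by S_1^2, so every entry, and with it every factor of a k-fold product, is at most
  S_1 in absolute value.\<close>

lemma S_sym_le_power_sum:
  fixes l :: "real^'n"
  assumes "1 \<le> k" "l \<in> Gamma_cone k"
  shows "0 < (\<Sum>i\<in>UNIV. l $ i)"
    and "S_sym k l \<le> real (CARD('n) choose k) * (\<Sum>i\<in>UNIV. l $ i) ^ k"
proof -
  let ?s = "\<Sum>i\<in>UNIV. l $ i"
  show pos: "0 < ?s" using assms by (auto simp: Gamma_cone_def S_sym_1[symmetric])
  show "S_sym k l \<le> real (CARD('n) choose k) * ?s ^ k"
  proof (cases "k = 1")
    case True
    have "1 * ?s \<le> real (CARD('n)) * ?s" using pos by (intro mult_right_mono) (auto simp: Suc_le_eq)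
    with True show ?thesis by (simp only: S_sym_1) simp
  next
    case False
    then have "0 < S_sym 2 l" using assms by (auto simp: Gamma_cone_def)
    then have "(\<Sum>i\<in>UNIV. (l $ i)\<^sup>2) \<le> ?s\<^sup>2" using sum_squared_eq_S_sym[of l] by simp
    moreover have "(l $ i)\<^sup>2 \<le> (\<Sum>i\<in>UNIV. (l $ i)\<^sup>2)" for i by (rule member_le_sum) auto
    ultimately have "(l $ i)\<^sup>2 \<le> ?s\<^sup>2" for i by (rule order_trans[rotated])
    then have bound: "\<bar>l $ i\<bar> \<le> ?s" for i using pos by (simp add: abs_le_square_iff[symmetric])
    have "S_sym k l \<le> (\<Sum>A | card (A::'n set) = k. ?s ^ k)"
      unfolding S_sym_def
    proof (rule sum_mono)
      fix A :: "'n set" assume "A \<in> {A. card A = k}"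
      then have "\<bar>\<Prod>i\<in>A. l $ i\<bar> \<le> (\<Prod>i\<in>A. ?s)" unfolding abs_prod by (intro prod_mono) (auto simp: bound)
      with \<open>A \<in> _\<close> show "(\<Prod>i\<in>A. l $ i) \<le> ?s ^ k" by simp
    qed
    also have "\<dots> = real (card {A. A \<subseteq> (UNIV::'n set) \<and> card A = k}) * ?s ^ k" by simp
    finally show ?thesis by (simp only: n_subsets finite)
  qed
qed

text \<open>Every index lies in (n - 1 choose k - 1) of the sets of size k.\<close>

lemma sum_over_subsets:
  fixes l :: "real^'n"
  assumes "1 \<le> k"
  shows "(\<Sum>A | card A = k. \<Sum>i\<in>A. l $ i) = real ((CARD('n) - 1) choose (k - 1)) * (\<Sum>i\<in>UNIV. l $ i)"
proof -
  have cnt: "card {A::'n set. card A = k \<and> i \<in> A} = (CARD('n) - 1) choose (k - 1)" for i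
  proof -
    have "{A::'n set. card A = k \<and> i \<in> A} = insert i ` {B. B \<subseteq> UNIV - {i} \<and> card B = k - 1}"
    proof (intro set_eqI iffI)
      fix A :: "'n set" assume "A \<in> {A. card A = k \<and> i \<in> A}"
      then show "A \<in> insert i ` {B. B \<subseteq> UNIV - {i} \<and> card B = k - 1}"
        by (intro image_eqI[of _ _ "A - {i}"]) auto
    next
      fix A :: "'n set" assume "A \<in> insert i ` {B. B \<subseteq> UNIV - {i} \<and> card B = k - 1}"
      then show "A \<in> {A. card A = k \<and> i \<in> A}" using assms by (auto simp: card_insert_if subset_eq)
    qed
    moreover have "inj_on (insert i) {B. B \<subseteq> UNIV - {i} \<and> card B = k - 1}"
      by (auto simp: inj_on_def)
    ultimately show ?thesis by (simp add: card_image n_subsets)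
  qed
  have "(\<Sum>A | card A = k. \<Sum>i\<in>A. l $ i) = (\<Sum>A | card A = k. \<Sum>i | i \<in> UNIV \<and> i \<in> A. l $ i)" by simp
  also have "\<dots> = (\<Sum>i\<in>UNIV. \<Sum>A | A \<in> {A. card A = k} \<and> i \<in> A. l $ i)"
    by (rule sum.swap_restrict) auto
  finally show ?thesis by (simp add: cnt sum_distrib_left)
qed

text \<open>All k-fold sums are positive, so each of them is at most their total, a multiple of S_1.\<close>

lemma Pi_sym_le_power_sum:
  fixes l :: "real^'n"
  assumes "1 \<le> k" "k \<le> CARD('n)" "l \<in> P_cone k"
  shows "0 < (\<Sum>i\<in>UNIV. l $ i)"
    and "Pi_sym k l \<le> (real ((CARD('n) - 1) choose (k - 1)) * (\<Sum>i\<in>UNIV. l $ i)) ^ (CARD('n) choose k)"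
proof -
  have card: "card {A::'n set. card A = k} = CARD('n) choose k" using n_subsets[of "UNIV::'n set" k] by simp
  then have "card {A::'n set. card A = k} > 0" using assms(2) by (simp add: zero_less_binomial_iff)
  then have ne: "{A::'n set. card A = k} \<noteq> {}" by force
  have "0 < (\<Sum>A | card A = k. \<Sum>i\<in>A. l $ i)"
    by (rule sum_pos) (use ne assms(3) in \<open>auto simp: P_cone_def\<close>)
  then show "0 < (\<Sum>i\<in>UNIV. l $ i)"
    unfolding sum_over_subsets[OF assms(1)] by (metis mult_nonneg_nonpos not_le of_nat_0_le_iff)
  have "Pi_sym k l \<le> (\<Prod>A | card (A::'n set) = k. \<Sum>A | card A = k. \<Sum>i\<in>A. l $ i)"
    unfolding Pi_sym_def
  proof (rule prod_mono, intro conjI)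
    fix A :: "'n set" assume A: "A \<in> {A. card A = k}"
    then show "0 \<le> (\<Sum>i\<in>A. l $ i)" using assms(3) by (force simp: P_cone_def intro: less_imp_le)
    show "(\<Sum>i\<in>A. l $ i) \<le> (\<Sum>A | card A = k. \<Sum>i\<in>A. l $ i)"
      using A assms(3) by (intro member_le_sum[of A _ "\<lambda>A. \<Sum>i\<in>A. l $ i"]) (force simp: P_cone_def intro: less_imp_le)+
  qed
  then show "Pi_sym k l \<le> (real ((CARD('n) - 1) choose (k - 1)) * (\<Sum>i\<in>UNIV. l $ i)) ^ (CARD('n) choose k)"
    by (simp add: card sum_over_subsets[OF assms(1)])
qed

text \<open>Together with \<open>root_Pi_mat_le_trace\<close> below, this reduces both equations to an inequality for the
  trace, that is, for the p-Laplacian.\<close>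

lemma root_S_mat_le_trace:
  assumes "1 \<le> k" "k \<le> CARD('n)"
  obtains K where "0 < K"
    "\<And>M::real^'n^'n. (\<exists>l. has_eigenvalues M l) \<Longrightarrow> eigenvalues M \<in> Gamma_cone k \<Longrightarrow>
      0 < trace M \<and> root k (S_mat k M) \<le> K * trace M"
proof
  let ?K = "root k (real (CARD('n) choose k))"
  show "0 < ?K" using assms by simp
  fix M :: "real^'n^'n"
  assume "\<exists>l. has_eigenvalues M l" and cone: "eigenvalues M \<in> Gamma_cone k"
  then have tr: "trace M = (\<Sum>i\<in>UNIV. eigenvalues M $ i)"
    using has_eigenvalues_eigenvalues trace_eq_sum_eigenvalues by blast
  have pos: "0 < trace M" unfolding tr by (rule S_sym_le_power_sum(1)[OF assms(1) cone])
  have "root k (S_mat k M) \<le> root k (real (CARD('n) choose k) * trace M ^ k)"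
    using S_sym_le_power_sum(2)[OF assms(1) cone] assms(1) by (simp add: S_mat_def tr)
  also have "\<dots> = ?K * trace M" using assms(1) pos by (simp add: real_root_mult real_root_power_cancel)
  finally show "0 < trace M \<and> root k (S_mat k M) \<le> ?K * trace M" using pos by blast
qed

lemma root_Pi_mat_le_trace:
  assumes "1 \<le> k" "k \<le> CARD('n)"
  obtains K where "0 < K"
    "\<And>M::real^'n^'n. (\<exists>l. has_eigenvalues M l) \<Longrightarrow> eigenvalues M \<in> P_cone k \<Longrightarrow>
      0 < trace M \<and> root (CARD('n) choose k) (Pi_mat k M) \<le> K * trace M"
proof
  let ?K = "real ((CARD('n) - 1) choose (k - 1))"
  have N: "0 < CARD('n) choose k" using assms(2) by (simp add: zero_less_binomial_iff)
  show "0 < ?K" using assms by (simp add: zero_less_binomial_iff)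
  fix M :: "real^'n^'n"
  assume "\<exists>l. has_eigenvalues M l" and cone: "eigenvalues M \<in> P_cone k"
  then have tr: "trace M = (\<Sum>i\<in>UNIV. eigenvalues M $ i)"
    using has_eigenvalues_eigenvalues trace_eq_sum_eigenvalues by blast
  have pos: "0 < trace M" unfolding tr by (rule Pi_sym_le_power_sum(1)[OF assms cone])
  have "root (CARD('n) choose k) (Pi_mat k M) \<le> root (CARD('n) choose k) ((?K * trace M) ^ (CARD('n) choose k))"
    using Pi_sym_le_power_sum(2)[OF assms cone] N by (simp add: Pi_mat_def tr)
  also have "\<dots> = ?K * trace M" using N pos by (intro real_root_power_cancel) auto
  finally show "0 < trace M \<and> root (CARD('n) choose k) (Pi_mat k M) \<le> ?K * trace M" using pos by blast
qed

section \<open>Gradients and Jacobians along lines\<close>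

lemma has_derivative_grad:
  fixes u :: "real^'n \<Rightarrow> real"
  assumes "u differentiable (at x)"
  shows "(u has_derivative (\<lambda>h. grad u x \<bullet> h)) (at x)"
proof -
  let ?D = "frechet_derivative u (at x)"
  have D: "(u has_derivative ?D) (at x)" using assms by (simp add: frechet_derivative_works)
  then interpret D: linear ?D by (rule has_derivative_linear)
  have "?D = (\<lambda>h. grad u x \<bullet> h)"
  proof
    fix h
    have "?D h = ?D (\<Sum>i\<in>UNIV. h $ i *\<^sub>R axis i 1)"
      by (simp add: basis_expansion scalar_mult_eq_scaleR[symmetric])
    then show "?D h = grad u x \<bullet> h" by (simp add: D.sum D.scaleR grad_def partial_def inner_vec_def mult.commute)
  qed
  with D show ?thesis by metis
qed

lemma grad_eqI:
  fixes u :: "real^'n \<Rightarrow> real"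
  assumes "(u has_derivative (\<lambda>h. g \<bullet> h)) (at x)"
  shows "grad u x = g"
  using frechet_derivative_at[OF assms, symmetric]
  by (simp add: grad_def partial_def vec_eq_iff inner_axis)

lemma grad_at_local_max:
  fixes u :: "real^'n \<Rightarrow> real"
  assumes "u differentiable (at x)" "0 < \<rho>" "\<And>y. dist x y < \<rho> \<Longrightarrow> u y \<le> u x"
  shows "grad u x = 0"
proof -
  have "(\<lambda>h. grad u x \<bullet> h) = (\<lambda>h. 0)"
    using differential_zero_maxmin[of x "ball x \<rho>" u, OF _ _ has_derivative_grad[OF assms(1)]] assms(2,3)
    by auto
  then have "grad u x \<bullet> grad u x = 0" by meson
  then show ?thesis by simp
qed

lemma grad_along_line:
  fixes u :: "real^'n \<Rightarrow> real"
  assumes "u differentiable (at (x + t *\<^sub>R y))"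
  shows "((\<lambda>t. u (x + t *\<^sub>R y)) has_real_derivative (grad u (x + t *\<^sub>R y) \<bullet> y)) (at t)"
proof -
  have "((\<lambda>t. x + t *\<^sub>R y) has_derivative (\<lambda>h. h *\<^sub>R y)) (at t)"
    by (auto intro!: derivative_eq_intros)
  from has_derivative_compose[OF this has_derivative_grad[OF assms]] show ?thesis
    by (simp add: has_field_derivative_def mult.commute[of _ "_ \<bullet> _"] mult_commute_abs)
qed

lemma field_along_line:
  fixes F :: "real^'n \<Rightarrow> real^'n"
  assumes "F differentiable (at x)"
  shows "((\<lambda>t. F (x + t *\<^sub>R y) \<bullet> y) has_real_derivative ((jacobian F (at x) *v y) \<bullet> y)) (at 0)"
proof -
  have l: "((\<lambda>t. x + t *\<^sub>R y) has_derivative (\<lambda>h. h *\<^sub>R y)) (at 0)"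
    by (auto intro!: derivative_eq_intros)
  have "(F has_derivative (\<lambda>h. jacobian F (at x) *v h)) (at (x + 0 *\<^sub>R y))"
    using assms by (simp add: jacobian_works)
  from has_derivative_compose[OF l this]
  have "((\<lambda>t. F (x + t *\<^sub>R y) \<bullet> y) has_derivative (\<lambda>h. (jacobian F (at x) *v (h *\<^sub>R y)) \<bullet> y)) (at 0)"
    by (rule has_derivative_inner_left)
  then show ?thesis
    by (simp add: has_field_derivative_def matrix_vector_mult_scaleR mult_commute_abs)
qed

lemma C1_field_onI:
  assumes "\<And>x. x \<in> U \<Longrightarrow> (F has_derivative (\<lambda>h. J x *v h)) (at x)" "continuous_on U J"
  shows "C1_field_on U F"
    and "\<And>x. x \<in> U \<Longrightarrow> jacobian F (at x) = J x"
proof -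
  show j: "jacobian F (at x) = J x" if "x \<in> U" for x
    using frechet_derivative_at[OF assms(1)[OF that], symmetric] by (simp add: jacobian_def matrix_of_matrix_vector_mul)
  show "C1_field_on U F"
    unfolding C1_field_on_def
    using assms j by (auto simp: differentiable_def cong: continuous_on_cong)
qed

section \<open>Power fields\<close>

text \<open>The gradient of a radial power and its field |Du|^(p-2) Du are multiples of such fields, and the
  map that takes Du to |Du|^(p-2) Du is one itself.\<close>

definition power_field :: "real \<Rightarrow> real^'n \<Rightarrow> real^'n" where
  "power_field s x = norm x powr s *\<^sub>R x"

text \<open>The matrix |x|^s I + s |x|^(s-2) x x^T. With the convention \<open>0 powr s = 0\<close> it is the zero matrix
  at the origin, which is the true Jacobian there for s > 0 but not for s = 0.\<close>

definition power_field_jacobian :: "real \<Rightarrow> real^'n \<Rightarrow> real^'n^'n" where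
  "power_field_jacobian s x =
     (\<chi> i j. norm x powr s * (if i = j then 1 else 0) + s * norm x powr (s - 2) * (x $ i * x $ j))"

lemma power_field_jacobian_mult:
  "power_field_jacobian s x *v h = norm x powr s *\<^sub>R h + (s * norm x powr (s - 2) * (x \<bullet> h)) *\<^sub>R x"
  by (simp add: vec_eq_iff power_field_jacobian_def matrix_vector_mult_def inner_vec_def distrib_right
      sum.distrib sum_distrib_left sum_distrib_right if_distrib[of "\<lambda>a. _ * a * _"] cong: if_cong)
     (simp add: algebra_simps)

lemma norm_powr_eq: "norm x powr s = (x \<bullet> x) powr (s / 2)" for x :: "'a::real_inner"
  by (simp add: norm_eq_sqrt_inner powr_half_sqrt[symmetric] powr_powr)

lemma has_derivative_norm_powr:
  fixes x :: "'a::real_inner"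
  assumes "x \<noteq> 0"
  shows "((\<lambda>x. norm x powr s) has_derivative (\<lambda>h. s * norm x powr (s - 2) * (x \<bullet> h))) (at x)"
proof -
  have "((\<lambda>z. z powr (s/2)) has_derivative (*) (s/2 * (x \<bullet> x) powr (s/2 - 1))) (at (x \<bullet> x))"
    using has_real_derivative_powr[of "x \<bullet> x" "s/2"] assms by (simp add: has_field_derivative_def)
  moreover have "((\<lambda>x. x \<bullet> x) has_derivative (\<lambda>h. 2 * (x \<bullet> h))) (at x)"
    by (auto intro!: derivative_eq_intros simp: inner_commute)
  ultimately have "((\<lambda>x. (x \<bullet> x) powr (s/2)) has_derivative (\<lambda>h. s/2 * (x \<bullet> x) powr (s/2 - 1) * (2 * (x \<bullet> h)))) (at x)"
    by (rule has_derivative_compose[rotated])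
  then show ?thesis by (simp add: norm_powr_eq diff_divide_distrib mult.assoc)
qed

lemma has_derivative_power_field:
  assumes "x \<noteq> 0"
  shows "(power_field s has_derivative (\<lambda>h. power_field_jacobian s x *v h)) (at x)"
  unfolding power_field_jacobian_mult power_field_def [abs_def]
  by (rule has_derivative_scaleR[OF has_derivative_norm_powr[OF assms] has_derivative_ident])

lemma has_derivative_at_0_of_growth:
  fixes F :: "'a::real_normed_vector \<Rightarrow> 'b::real_normed_vector"
  assumes "1 < a" "\<And>x. norm (F x) \<le> C * norm x powr a"
  shows "(F has_derivative (\<lambda>h. 0)) (at 0)"
proof -
  have F0: "F 0 = 0" using assms(2)[of 0] by simp
  have "((\<lambda>h. \<bar>C\<bar> * norm h powr (a - 1)) \<longlongrightarrow> \<bar>C\<bar> * 0 powr (a - 1)) (at (0::'a))"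
    using assms(1) by (intro tendsto_intros tendsto_norm_zero) (auto intro!: always_eventually)
  then have lim: "((\<lambda>h. \<bar>C\<bar> * norm h powr (a - 1)) \<longlongrightarrow> 0) (at (0::'a))" by simp
  have "((\<lambda>h. norm (F h) / norm h) \<longlongrightarrow> 0) (at (0::'a))"
  proof (rule tendsto_sandwich[OF _ _ tendsto_const lim])
    show "\<forall>\<^sub>F h in at (0::'a). norm (F h) / norm h \<le> \<bar>C\<bar> * norm h powr (a - 1)"
      unfolding eventually_at_filter
    proof (intro always_eventually allI impI)
      fix h :: 'a assume "h \<noteq> 0"
      have "norm (F h) \<le> \<bar>C\<bar> * norm h powr a"
        using assms(2)[of h] by (rule order_trans) (simp add: mult_right_mono)
      also have "\<dots> = (\<bar>C\<bar> * norm h powr (a - 1)) * norm h"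
        using \<open>h \<noteq> 0\<close> by (simp add: powr_diff)
      finally show "norm (F h) / norm h \<le> \<bar>C\<bar> * norm h powr (a - 1)"
        using \<open>h \<noteq> 0\<close> by (simp add: pos_divide_le_eq)
    qed
  qed auto
  then show ?thesis by (simp add: has_derivative_at F0)
qed

lemma norm_power_field: "norm (power_field s x) = norm x powr (s + 1)"
  by (cases "x = 0") (simp_all add: power_field_def powr_add)

lemma continuous_on_power_field_jacobian:
  "continuous_on (- {0 :: real^'n}) (power_field_jacobian s)"
  unfolding power_field_jacobian_def [abs_def]
  by (intro continuous_intros) auto

lemma C1_power_field_away:
  shows "C1_field_on (- {0}) (power_field s)"
    and "\<And>x. x \<noteq> 0 \<Longrightarrow> jacobian (power_field s) (at x) = power_field_jacobian s x"
  by (auto intro!: C1_field_onI(1) C1_field_onI(2)[of "- {0}"]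
      has_derivative_power_field continuous_on_power_field_jacobian)

lemma power_field_bounds:
  fixes x :: "real^'n"
  shows "\<bar>power_field s x $ i\<bar> \<le> norm x powr (s + 1)"
    and "\<bar>power_field_jacobian s x $ j $ i\<bar> \<le> (1 + \<bar>s\<bar>) * norm x powr s"
proof -
  show "\<bar>power_field s x $ i\<bar> \<le> norm x powr (s + 1)"
    using component_le_norm_cart[of "power_field s x" i] by (simp add: norm_power_field)
  have "\<bar>x $ j * x $ i\<bar> \<le> norm x * norm x"
    unfolding abs_mult by (intro mult_mono component_le_norm_cart) auto
  then have "norm x powr (s - 2) * \<bar>x $ j * x $ i\<bar> \<le> norm x powr (s - 2) * (norm x * norm x)"
    by (intro mult_left_mono) auto
  also have "\<dots> = norm x powr s" by (cases "x = 0") (simp_all add: powr_diff power2_eq_square)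
  finally have "\<bar>s\<bar> * (norm x powr (s - 2) * \<bar>x $ j * x $ i\<bar>) \<le> \<bar>s\<bar> * norm x powr s"
    by (intro mult_left_mono) auto
  then have 1: "\<bar>s * norm x powr (s - 2) * (x $ j * x $ i)\<bar> \<le> \<bar>s\<bar> * norm x powr s" by (simp add: abs_mult mult_ac)
  have 2: "\<bar>norm x powr s * (if j = i then 1 else 0)\<bar> \<le> norm x powr s" by simp
  show "\<bar>power_field_jacobian s x $ j $ i\<bar> \<le> (1 + \<bar>s\<bar>) * norm x powr s"
    using order_trans[OF abs_triangle_ineq add_mono[OF 2 1]]
    by (simp only: power_field_jacobian_def vec_lambda_beta distrib_right mult_1)
qed

text \<open>At the origin the field is o(|x|) and its Jacobian is O(|x|^s) if s > 0. For s = 0 the field is the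
  identity, whose Jacobian differs from the formula at the origin.\<close>

lemma C1_power_field:
  assumes "0 \<le> s"
  shows "C1_field_on UNIV (power_field s :: real^'n \<Rightarrow> real^'n)"
proof (cases "s = 0")
  case True
  have "power_field s = (\<lambda>x::real^'n. x)" using True by (auto simp: power_field_def fun_eq_iff)
  moreover have "C1_field_on UNIV (\<lambda>x::real^'n. x)"
    by (rule C1_field_onI[where J = "\<lambda>_. mat 1"]) (auto intro!: derivative_eq_intros)
  ultimately show ?thesis by simp
next
  case False
  with assms have s: "0 < s" by simp
  have J0: "power_field_jacobian s 0 = (0::real^'n^'n)"
    by (simp add: power_field_jacobian_def vec_eq_iff)
  have der: "(power_field s has_derivative (\<lambda>h. power_field_jacobian s x *v h)) (at x)" for x :: "real^'n"
    proof (cases "x = 0")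
      case True
      have "(power_field s has_derivative (\<lambda>h::real^'n. 0::real^'n)) (at 0)"
        by (rule has_derivative_at_0_of_growth[of "s+1" _ 1]) (use s in \<open>auto simp: norm_power_field\<close>)
      then show ?thesis using True by (simp add: J0)
    qed (rule has_derivative_power_field)
  have cont: "isCont (power_field_jacobian s) x" for x :: "real^'n"
    proof (cases "x = 0")
      case False
      then show ?thesis
        using continuous_on_power_field_jacobian[of s, where 'n = 'n]
        by (simp add: continuous_on_eq_continuous_at open_Compl)
    next
      case True
      have "((\<lambda>y. power_field_jacobian s y $ i $ j) \<longlongrightarrow> 0) (at (0::real^'n))" for i j
      proof (rule Lim_null_comparison)
        show "\<forall>\<^sub>F y in at (0::real^'n). norm (power_field_jacobian s y $ i $ j) \<le> (1 + s) * norm y powr s"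
          using power_field_bounds(2)[of s _ i j] s by (intro always_eventually allI) simp
        have "((\<lambda>y. (1 + s) * norm y powr s) \<longlongrightarrow> (1 + s) * 0 powr s) (at (0::real^'n))"
          using s by (intro tendsto_intros tendsto_norm_zero) (auto intro!: always_eventually)
        then show "((\<lambda>y. (1 + s) * norm y powr s) \<longlongrightarrow> 0) (at (0::real^'n))" by simp
      qed
      then have "(power_field_jacobian s \<longlongrightarrow> 0) (at (0::real^'n))"
        by (intro vec_tendstoI) simp
      then show ?thesis using True by (simp add: isCont_def J0)
    qed
  show ?thesis
    by (rule C1_field_onI[OF der]) (simp add: continuous_at_imp_continuous_on cont)
qed

lemma C1_field_scaleR:
  assumes "C1_field_on U F"
  shows "C1_field_on U (\<lambda>x. c *\<^sub>R F x)"
    and "\<And>x. x \<in> U \<Longrightarrow> jacobian (\<lambda>x. c *\<^sub>R F x) (at x) = c *\<^sub>R jacobian F (at x)"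
proof -
  have 1: "((\<lambda>x. c *\<^sub>R F x) has_derivative (\<lambda>h. (c *\<^sub>R jacobian F (at x)) *v h)) (at x)" if "x \<in> U" for x
    using assms that unfolding C1_field_on_def jacobian_works
    by (auto intro!: derivative_eq_intros simp: scaleR_matrix_vector_assoc)
  have 2: "continuous_on U (\<lambda>x. c *\<^sub>R jacobian F (at x))"
    using assms unfolding C1_field_on_def by (intro continuous_intros) auto
  show "C1_field_on U (\<lambda>x. c *\<^sub>R F x)"
    and "\<And>x. x \<in> U \<Longrightarrow> jacobian (\<lambda>x. c *\<^sub>R F x) (at x) = c *\<^sub>R jacobian F (at x)"
    using C1_field_onI[OF 1 2] by blast+
qed

lemma has_derivative_norm_powr_everywhere:
  fixes x :: "real^'n"
  assumes "1 < a"
  shows "((\<lambda>x. norm x powr a) has_derivative (\<lambda>h. (a *\<^sub>R power_field (a - 2) x) \<bullet> h)) (at x)"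
proof (cases "x = 0")
  case True
  have "((\<lambda>x::real^'n. norm x powr a) has_derivative (\<lambda>h. 0)) (at 0)"
    by (rule has_derivative_at_0_of_growth[of a _ 1]) (use assms in auto)
  then show ?thesis using True by (simp add: power_field_def)
next
  case False
  then show ?thesis using has_derivative_norm_powr[OF False, of a]
    by (simp add: power_field_def mult.assoc)
qed

section \<open>Touching by radial functions\<close>

lemma inner_vector_matrix_mult: "x \<bullet> (z v* R) = (R *v x) \<bullet> z" for R :: "real^'n^'m"
  by (metis dot_lmul_matrix inner_commute)

lemma trace_orthonormal:
  fixes H R :: "real^'n^'n"
  assumes "orthogonal_matrix R"
  shows "trace H = (\<Sum>i\<in>UNIV. (R *v axis i 1) \<bullet> (H *v (R *v axis i 1)))"
proof -
  have "trace H = trace (R ** (transpose R ** H))"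
    using assms by (simp add: matrix_mul_assoc orthogonal_matrix_def)
  also have "\<dots> = trace ((transpose R ** H) ** R)" by (rule trace_mul_sym)
  also have "\<dots> = (\<Sum>i\<in>UNIV. axis i 1 \<bullet> (((transpose R ** H) ** R) *v axis i 1))"
    by (simp add: trace_def inner_axis' matrix_vector_mult_basis column_def)
  also have "\<dots> = (\<Sum>i\<in>UNIV. (R *v axis i 1) \<bullet> (H *v (R *v axis i 1)))"
    by (simp add: matrix_vector_mul_assoc[symmetric] inner_vector_matrix_mult)
  finally show ?thesis .
qed

text \<open>In an orthonormal basis that contains \<open>e\<close>, the trace is the entry at \<open>e\<close> plus n - 1 entries in
  directions orthogonal to \<open>e\<close>, where the bound is \<open>a\<close>. The entry at \<open>e\<close> has total weight s + 1, which is
  positive even if s is negative.\<close>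

lemma weighted_trace_le:
  fixes H :: "real^'n^'n"
  assumes e: "norm e = 1" and s: "-1 < s"
    and H: "\<And>y. y \<bullet> (H *v y) \<le> a * (y \<bullet> y) + b * (e \<bullet> y)\<^sup>2"
  shows "trace H + s * (e \<bullet> (H *v e)) \<le> (real CARD('n) - 1) * a + (s + 1) * (a + b)"
proof -
  fix k :: 'n
  obtain R :: "real^'n^'n" where R: "orthogonal_matrix R" "R *v axis k 1 = e"
    using orthogonal_matrix_exists_basis[OF e] by blast
  define v where "v i = R *v axis i 1" for i
  have inner: "v i \<bullet> v j = (if i = j then 1 else 0)" for i j
  proof -
    have "v i \<bullet> v j = axis i 1 \<bullet> ((transpose R ** R) *v axis j (1::real))"
      by (simp add: v_def matrix_vector_mul_assoc[symmetric] inner_vector_matrix_mult)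
    then show ?thesis using R(1) by (simp add: orthogonal_matrix inner_axis_axis)
  qed
  have "trace H = v k \<bullet> (H *v v k) + (\<Sum>i\<in>UNIV - {k}. v i \<bullet> (H *v v i))"
    unfolding trace_orthonormal[OF R(1)] v_def by (rule sum.remove) auto
  also have "(\<Sum>i\<in>UNIV - {k}. v i \<bullet> (H *v v i)) \<le> (\<Sum>i\<in>UNIV - {k}. a)"
  proof (rule sum_mono)
    fix i assume "i \<in> UNIV - {k}"
    then show "v i \<bullet> (H *v v i) \<le> a"
      using H[of "v i"] inner[of i i] inner[of k i] R(2) by (simp add: v_def)
  qed
  also have "(\<Sum>i\<in>UNIV - {k}. a) = (real CARD('n) - 1) * a"
    by (simp add: of_nat_diff)
  finally have "trace H \<le> e \<bullet> (H *v e) + (real CARD('n) - 1) * a" using R(2) by (simp add: v_def)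
  moreover have "(s + 1) * (e \<bullet> (H *v e)) \<le> (s + 1) * (a + b)"
    using H[of e] e s by (intro mult_left_mono) (auto simp: norm_eq_1)
  ultimately show ?thesis by (simp add: algebra_simps)
qed

text \<open>For c e = Du(x), H = D^2 u(x) and s = p - 2 this is the non-divergence form
  |Du|^(p-2) (\<Delta>u + (p - 2) e \<sqdot> D^2 u e) of the p-Laplacian.\<close>

lemma trace_power_field_jacobian_mult:
  fixes H :: "real^'n^'n"
  assumes "norm e = 1" "c \<noteq> 0"
  shows "trace (power_field_jacobian s (c *\<^sub>R e) ** H) = \<bar>c\<bar> powr s * (trace H + s * (e \<bullet> (H *v e)))"
proof -
  have c2: "\<bar>c\<bar> powr (s - 2) * (c * c) = \<bar>c\<bar> powr s"
    using assms(2) by (simp add: powr_diff power2_eq_square)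
  have "trace (power_field_jacobian s (c *\<^sub>R e) ** H)
      = (\<Sum>i\<in>UNIV. \<Sum>j\<in>UNIV. \<bar>c\<bar> powr s * (if i = j then 1 else 0) * H $ j $ i
          + s * (\<bar>c\<bar> powr (s - 2) * (c * c)) * (e $ i * e $ j * H $ j $ i))"
    using assms(1) by (simp add: trace_def matrix_matrix_mult_def power_field_jacobian_def algebra_simps)
  also have "\<dots> = \<bar>c\<bar> powr s * trace H + s * \<bar>c\<bar> powr s * (\<Sum>i\<in>UNIV. \<Sum>j\<in>UNIV. e $ i * e $ j * H $ j $ i)"
    unfolding c2 by (simp add: sum.distrib sum_distrib_left trace_def if_distrib[of "\<lambda>a. _ * a * _"] cong: if_cong)
  also have "(\<Sum>i\<in>UNIV. \<Sum>j\<in>UNIV. e $ i * e $ j * H $ j $ i) = e \<bullet> (H *v e)"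
    unfolding inner_vec_def matrix_vector_mult_def
    by (subst sum.swap) (simp add: sum_distrib_left algebra_simps)
  finally show ?thesis by (simp add: algebra_simps)
qed

lemma D_field_eq:
  assumes "grad u differentiable (at x)" "grad u x \<noteq> 0"
  shows "D_field p u x = power_field_jacobian (p - 2) (grad u x) ** jacobian (grad u) (at x)"
proof -
  have "(grad u has_derivative (\<lambda>h. jacobian (grad u) (at x) *v h)) (at x)"
    using assms(1) by (simp add: jacobian_works)
  from has_derivative_compose[OF this has_derivative_power_field[OF assms(2)]]
  have "(p_field p u has_derivative
      (\<lambda>h. (power_field_jacobian (p - 2) (grad u x) ** jacobian (grad u) (at x)) *v h)) (at x)"
    by (simp add: p_field_def[abs_def] power_field_def matrix_vector_mul_assoc)
  from frechet_derivative_at[OF this, symmetric] show ?thesis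
    by (simp add: D_field_def jacobian_def matrix_of_matrix_vector_mul)
qed

text \<open>A positive second derivative at 0 alone already makes \<open>h1\<close> positive, and hence \<open>h\<close> increasing, on an
  interval to the right of 0.\<close>

lemma second_derivative_at_local_max:
  fixes h :: "real \<Rightarrow> real"
  assumes "\<forall>\<^sub>F t in nhds 0. (h has_real_derivative h1 t) (at t)"
    and "(h1 has_real_derivative a) (at 0)"
    and "\<forall>\<^sub>F t in nhds 0. h t \<le> h 0"
  shows "h1 0 = 0" "a \<le> 0"
proof -
  from eventually_conj[OF assms(1,3)] obtain d where d: "0 < d"
    "\<And>t. \<bar>t\<bar> < d \<Longrightarrow> (h has_real_derivative h1 t) (at t) \<and> h t \<le> h 0"
    by (auto simp: eventually_nhds_metric dist_real_def)
  show 0: "h1 0 = 0" by (rule DERIV_local_max[of h _ 0 d]) (use d in auto)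
  show "a \<le> 0"
  proof (rule ccontr)
    assume "\<not> a \<le> 0"
    with has_real_derivative_pos_inc_right[OF assms(2)] obtain d' where d': "0 < d'"
      "\<And>t. 0 < t \<Longrightarrow> t < d' \<Longrightarrow> h1 0 < h1 t" by auto
    define t where "t = min d d' / 2"
    have t: "0 < t" "t < d" "t < d'" using d(1) d'(1) by (auto simp: t_def)
    have "h 0 < h t"
    proof (rule DERIV_pos_imp_increasing_open[OF t(1)])
      show "continuous_on {0..t} h"
        by (rule continuous_at_imp_continuous_on) (use d t in \<open>force intro: DERIV_isCont\<close>)
    qed (use d(2) d'(2) t 0 in force)
    then show False using d(2)[of t] t by simp
  qed
qed

text \<open>On every line through \<open>x\<close> the difference has a maximum at \<open>x\<close>. The first-order conditions identify
  Du(x), the second-order conditions bound the quadratic form of D^2 u(x) in the way that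
  \<open>weighted_trace_le\<close> requires with e = x / |x|. The bound obtained is the p-Laplacian of the radial
  function. Since its gradient at \<open>x\<close> is nonzero, the map from Du to |Du|^(p-2) Du can be
  differentiated there for every p.\<close>

lemma radial_touching:
  fixes u :: "real^'n \<Rightarrow> real"
  assumes x: "x \<noteq> 0" and p: "1 < p"
    and u1: "\<And>y. u differentiable (at y)" and u2: "grad u differentiable (at x)"
    and \<psi>: "\<forall>\<^sub>F t in nhds (x \<bullet> x). (\<psi> has_real_derivative \<psi>1 t) (at t)"
    and \<psi>1: "(\<psi>1 has_real_derivative \<psi>2) (at (x \<bullet> x))" and nz: "\<psi>1 (x \<bullet> x) \<noteq> 0"
    and max: "\<forall>\<^sub>F y in nhds x. u y - \<psi> (y \<bullet> y) \<le> u x - \<psi> (x \<bullet> x)"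
  shows "grad u x = (2 * \<psi>1 (x \<bullet> x)) *\<^sub>R x"
    and "trace (D_field p u x) \<le> \<bar>2 * \<psi>1 (x \<bullet> x) * norm x\<bar> powr (p - 2) *
      ((real CARD('n) - 1) * (2 * \<psi>1 (x \<bullet> x)) + (p - 1) * (2 * \<psi>1 (x \<bullet> x) + 4 * (x \<bullet> x) * \<psi>2))"
proof -
  let ?s = "x \<bullet> x" and ?H = "jacobian (grad u) (at x)"
  have line: "grad u x \<bullet> y - \<psi>1 ?s * (2 * (x \<bullet> y)) = 0"
    "y \<bullet> (?H *v y) \<le> 2 * \<psi>1 ?s * (y \<bullet> y) + 4 * \<psi>2 * (x \<bullet> y)\<^sup>2" for y
  proof -
    let ?l = "\<lambda>t. x + t *\<^sub>R y" and ?q = "\<lambda>t. (x + t *\<^sub>R y) \<bullet> (x + t *\<^sub>R y)"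
    let ?q1 = "\<lambda>t. 2 * (x \<bullet> y) + 2 * t * (y \<bullet> y)"
    have ql: "filterlim ?l (nhds x) (nhds 0)" and qq: "filterlim ?q (nhds ?s) (nhds 0)"
      by (auto intro!: tendsto_eq_intros filterlim_ident)
    have dq: "(?q has_real_derivative ?q1 t) (at t)" for t
      by (auto intro!: derivative_eq_intros simp: inner_add inner_commute has_field_derivative_def algebra_simps fun_eq_iff)
    let ?h = "\<lambda>t. u (?l t) - \<psi> (?q t)" and ?h1 = "\<lambda>t. grad u (?l t) \<bullet> y - \<psi>1 (?q t) * ?q1 t"
    have 1: "\<forall>\<^sub>F t in nhds 0. (?h has_real_derivative ?h1 t) (at t)"
      using eventually_compose_filterlim[OF \<psi> qq]
    proof eventually_elim
      case (elim t)
      show ?case by (intro DERIV_diff grad_along_line u1 DERIV_chain2[OF elim dq])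
    qed
    have "((\<lambda>t. \<psi>1 (?q t)) has_real_derivative \<psi>2 * ?q1 0) (at 0)"
      by (rule DERIV_chain2[of \<psi>1 \<psi>2 ?q 0]) (use \<psi>1 dq[of 0] in auto)
    moreover have "(?q1 has_real_derivative 2 * (y \<bullet> y)) (at 0)"
      by (auto intro!: derivative_eq_intros)
    ultimately have "((\<lambda>t. \<psi>1 (?q t) * ?q1 t) has_real_derivative (\<psi>2 * ?q1 0 * ?q1 0 + 2 * (y \<bullet> y) * \<psi>1 (?q 0))) (at 0)"
      by (rule DERIV_mult)
    then have 2: "(?h1 has_real_derivative ((?H *v y) \<bullet> y - (\<psi>2 * ?q1 0 * ?q1 0 + 2 * (y \<bullet> y) * \<psi>1 (?q 0)))) (at 0)"
      by (intro DERIV_diff field_along_line u2)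
    have 3: "\<forall>\<^sub>F t in nhds 0. ?h t \<le> ?h 0" using eventually_compose_filterlim[OF max ql] by simp
    show "grad u x \<bullet> y - \<psi>1 ?s * (2 * (x \<bullet> y)) = 0"
      using second_derivative_at_local_max(1)[OF 1 2 3] by simp
    show "y \<bullet> (?H *v y) \<le> 2 * \<psi>1 ?s * (y \<bullet> y) + 4 * \<psi>2 * (x \<bullet> y)\<^sup>2"
      using second_derivative_at_local_max(2)[OF 1 2 3]
      by (simp add: power2_eq_square inner_commute algebra_simps)
  qed
  have "(grad u x - (2 * \<psi>1 ?s) *\<^sub>R x) \<bullet> y = 0" for y
    using line(1)[of y] by (simp add: inner_diff_left)
  then show g: "grad u x = (2 * \<psi>1 ?s) *\<^sub>R x" by (metis inner_eq_zero_iff right_minus_eq)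
  define e where "e = x /\<^sub>R norm x"
  have e: "norm e = 1" and xe: "x = norm x *\<^sub>R e" using x by (auto simp: e_def)
  have ge: "grad u x = (2 * \<psi>1 ?s * norm x) *\<^sub>R e" unfolding g by (subst (2) xe) simp
  have "y \<bullet> (?H *v y) \<le> 2 * \<psi>1 ?s * (y \<bullet> y) + 4 * ?s * \<psi>2 * (e \<bullet> y)\<^sup>2" for y
    using line(2)[of y] by (subst (asm) (4) xe) (simp add: power2_norm_eq_inner[symmetric] power_mult_distrib mult_ac)
  then have "trace ?H + (p - 2) * (e \<bullet> (?H *v e)) \<le> (real CARD('n) - 1) * (2 * \<psi>1 ?s) + (p - 2 + 1) * (2 * \<psi>1 ?s + 4 * ?s * \<psi>2)"
    using e p by (intro weighted_trace_le) auto
  moreover have "trace (D_field p u x) = \<bar>2 * \<psi>1 ?s * norm x\<bar> powr (p - 2) * (trace ?H + (p - 2) * (e \<bullet> (?H *v e)))"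
  proof -
    have "grad u x \<noteq> 0" using nz x by (simp add: g)
    from D_field_eq[OF u2 this, of p] show ?thesis
      unfolding ge using nz x by (simp add: trace_power_field_jacobian_mult[OF e])
  qed
  ultimately show "trace (D_field p u x) \<le> \<bar>2 * \<psi>1 ?s * norm x\<bar> powr (p - 2) *
      ((real CARD('n) - 1) * (2 * \<psi>1 ?s) + (p - 1) * (2 * \<psi>1 ?s + 4 * ?s * \<psi>2))"
    by (simp add: mult_left_mono)
qed

section \<open>Strong maximum principle\<close>

text \<open>What an admissible function of either regularity class has in common: the trace is the p-Laplacian
  of \<open>u\<close>, and nothing beyond differentiability is known at the origin.\<close>

definition strictly_p_subharmonic :: "real \<Rightarrow> (real^'n \<Rightarrow> real) \<Rightarrow> bool" where
  "strictly_p_subharmonic p u \<longleftrightarrow> (\<forall>x. u differentiable (at x)) \<and>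
     (\<forall>x. x \<noteq> 0 \<longrightarrow> grad u differentiable (at x) \<and> p_field p u differentiable (at x) \<and> 0 < trace (D_field p u x))"

text \<open>The field V = |Du|^(p-2) Du vanishes at \<open>x\<close> and its Jacobian A has positive trace, so y \<sqdot> A y > 0
  for some \<open>y\<close>. Hence V \<sqdot> y > 0, and so Du \<sqdot> y > 0, at all x + t y with small t > 0. The condition
  y \<sqdot> A y > 0 is open and invariant under sign change, so \<open>y\<close> can be made to point strictly inwards.\<close>

lemma inward_increase_at_critical_point:
  fixes u :: "real^'n \<Rightarrow> real"
  assumes u: "strictly_p_subharmonic p u" and x: "x \<noteq> 0" and crit: "grad u x = 0"
  obtains y where "x \<bullet> y < 0" "\<forall>\<^sub>F t in at_right 0. u x < u (x + t *\<^sub>R y)"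
proof -
  let ?A = "D_field p u x"
  have V: "p_field p u differentiable (at x)" and tr: "0 < trace ?A"
    using u x by (auto simp: strictly_p_subharmonic_def)
  have "\<exists>i. 0 < ?A $ i $ i"
  proof (rule ccontr)
    assume "\<nexists>i. 0 < ?A $ i $ i"
    then have "trace ?A \<le> 0" unfolding trace_def by (intro sum_nonpos) (auto simp: not_less)
    with tr show False by simp
  qed
  then obtain i where i: "0 < ?A $ i $ i" ..
  \<comment> \<open>The sign makes the axis direction point weakly inwards; subtracting a small multiple of \<open>x\<close>
    makes it strict.\<close>
  define c :: real where "c = (if x $ i \<le> 0 then 1 else -1)"
  have c: "c * c = 1" "c * x $ i \<le> 0" by (auto simp: c_def)
  define y0 :: "real^'n" where "y0 = c *\<^sub>R axis i 1"
  have "y0 \<bullet> (?A *v y0) = (c * c) * ?A $ i $ i"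
    by (simp add: y0_def inner_axis' matrix_vector_mult_basis column_def matrix_vector_mult_scaleR)
  then have y0: "x \<bullet> y0 \<le> 0" "0 < y0 \<bullet> (?A *v y0)"
    using i c by (simp_all add: y0_def inner_axis)
  have "((\<lambda>\<epsilon>. (y0 - \<epsilon> *\<^sub>R x) \<bullet> (?A *v (y0 - \<epsilon> *\<^sub>R x))) \<longlongrightarrow> (y0 - 0 *\<^sub>R x) \<bullet> (?A *v (y0 - 0 *\<^sub>R x))) (at_right 0)"
    by (intro tendsto_intros bounded_linear.tendsto[OF matrix_vector_mul_bounded_linear])
  from order_tendstoD(1)[OF this, of 0]
  have "\<forall>\<^sub>F \<epsilon> in at_right 0. 0 < (y0 - \<epsilon> *\<^sub>R x) \<bullet> (?A *v (y0 - \<epsilon> *\<^sub>R x))"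
    using y0(2) by simp
  with eventually_at_right_less have "\<forall>\<^sub>F \<epsilon> in at_right (0::real). 0 < \<epsilon> \<and> 0 < (y0 - \<epsilon> *\<^sub>R x) \<bullet> (?A *v (y0 - \<epsilon> *\<^sub>R x))"
    by (rule eventually_conj)
  from eventually_happens'[OF _ this] obtain \<epsilon> where \<epsilon>: "0 < \<epsilon>" "0 < (y0 - \<epsilon> *\<^sub>R x) \<bullet> (?A *v (y0 - \<epsilon> *\<^sub>R x))"
    by auto
  define y where "y = y0 - \<epsilon> *\<^sub>R x"
  have "0 < \<epsilon> * (x \<bullet> x)" using \<epsilon>(1) x by simp
  then have xy: "x \<bullet> y < 0" using y0(1) by (simp add: y_def inner_diff_right)
  have "0 < (?A *v y) \<bullet> y" using \<epsilon>(2) by (simp add: y_def inner_commute)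
  with has_real_derivative_pos_inc_right[OF field_along_line[OF V, of y]]
  obtain d where d: "0 < d" "\<And>t. 0 < t \<Longrightarrow> t < d \<Longrightarrow> 0 < p_field p u (x + t *\<^sub>R y) \<bullet> y"
    by (auto simp: D_field_def p_field_def crit)
  have "u x < u (x + t *\<^sub>R y)" if t: "0 < t" "t < d" for t
  proof -
    have "u (x + 0 *\<^sub>R y) < u (x + t *\<^sub>R y)"
    proof (rule DERIV_pos_imp_increasing_open[OF t(1)])
      fix z assume "0 < z" "z < t"
      then have "0 < p_field p u (x + z *\<^sub>R y) \<bullet> y" using d(2) t by auto
      then have "0 < grad u (x + z *\<^sub>R y) \<bullet> y" by (auto simp: p_field_def zero_less_mult_iff not_less[symmetric])
      then show "\<exists>D. ((\<lambda>t. u (x + t *\<^sub>R y)) has_real_derivative D) (at z) \<and> 0 < D"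
        using u grad_along_line[of u x z y] unfolding strictly_p_subharmonic_def by blast
    next
      show "continuous_on {0..t} (\<lambda>t. u (x + t *\<^sub>R y))"
        using u by (intro continuous_at_imp_continuous_on ballI)
          (auto intro!: DERIV_isCont grad_along_line simp: strictly_p_subharmonic_def)
    qed
    then show ?thesis by simp
  qed
  with d(1) have "\<forall>\<^sub>F t in at_right 0. u x < u (x + t *\<^sub>R y)"
    by (auto simp: eventually_at_right_field intro!: exI[of _ d])
  with xy show thesis by (rule that)
qed

text \<open>Moving inwards from \<open>x\<close> stays in the ball where \<open>u x\<close> is supposed to be the maximum.\<close>

lemma no_critical_max_off_origin:
  fixes u :: "real^'n \<Rightarrow> real"
  assumes u: "strictly_p_subharmonic p u" and x: "x \<noteq> 0" "grad u x = 0"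
    and max: "\<And>y. norm y \<le> norm x \<Longrightarrow> u y \<le> u x"
  shows False
proof -
  obtain y where y: "x \<bullet> y < 0" "\<forall>\<^sub>F t in at_right 0. u x < u (x + t *\<^sub>R y)"
    using inward_increase_at_critical_point[OF u x] by blast
  have "((\<lambda>t. 2 * (x \<bullet> y) + t * (y \<bullet> y)) \<longlongrightarrow> 2 * (x \<bullet> y) + 0 * (y \<bullet> y)) (at_right 0)"
    by (intro tendsto_intros)
  from order_tendstoD(2)[OF this, of 0] have "\<forall>\<^sub>F t in at_right 0. 2 * (x \<bullet> y) + t * (y \<bullet> y) < 0"
    using y(1) by simp
  with y(2) eventually_at_right_less[of "0::real"]
  have "\<forall>\<^sub>F t in at_right (0::real). False"
  proof eventually_elim
    case (elim t)
    have "(x + t *\<^sub>R y) \<bullet> (x + t *\<^sub>R y) = x \<bullet> x + t * (2 * (x \<bullet> y) + t * (y \<bullet> y))"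
      by (simp add: inner_add inner_commute algebra_simps)
    also have "\<dots> \<le> x \<bullet> x" using elim by (simp add: mult_nonneg_nonpos)
    finally have "norm (x + t *\<^sub>R y) \<le> norm x" by (simp add: norm_le)
    with max[of "x + t *\<^sub>R y"] elim(1) show False by simp
  qed
  then show False by simp
qed

text \<open>The p-Laplacian says nothing at the origin itself, so u is compared with the cone u(0) - \<epsilon> |x|. For
  small \<epsilon> the cone lies above u on a small sphere, because u < u(0) there by the previous lemma. Its
  p-Laplacian is nonpositive and its gradient is nonzero off the tip, so u cannot touch it from below
  inside the sphere except at the tip. Thus u \<le> u(0) - \<epsilon> |x|, which contradicts Du(0) = 0.\<close>

lemma no_max_at_origin:
  fixes u :: "real^'n \<Rightarrow> real"
  assumes u: "strictly_p_subharmonic p u" and p: "1 < p" and \<rho>: "0 < \<rho>"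
    and max: "\<And>y. norm y \<le> \<rho> \<Longrightarrow> u y \<le> u 0"
  shows False
proof -
  define r where "r = \<rho> / 2"
  have r: "0 < r" "r < \<rho>" using \<rho> by (auto simp: r_def)
  have u1: "u differentiable (at y)" for y using u by (simp add: strictly_p_subharmonic_def)
  have cont: "continuous_on X u" for X
    by (intro continuous_at_imp_continuous_on ballI differentiable_imp_continuous_within u1)
  have less: "u y < u 0" if y: "norm y = r" for y
  proof (rule ccontr)
    assume "\<not> u y < u 0"
    with max[of y] y r have eq: "u y = u 0" by simp
    have "grad u y = 0"
    proof (rule grad_at_local_max[OF u1])
      fix z assume "dist y z < \<rho> - r"
      then have "norm z \<le> \<rho>" using y norm_triangle_sub[of z y] by (simp add: dist_norm norm_minus_commute)
      then show "u z \<le> u y" using max eq by simp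
    qed (use r in simp)
    moreover have "u z \<le> u y" if "norm z \<le> norm y" for z using max[of z] that eq r y by simp
    ultimately show False using no_critical_max_off_origin[OF u, of y] y r by auto
  qed
  have "sphere (0::real^'n) r \<noteq> {}" using r by simp
  with continuous_attains_sup[OF compact_sphere _ cont] obtain y0 where
    y0: "norm y0 = r" "\<And>y. norm y = r \<Longrightarrow> u y \<le> u y0" by (metis mem_sphere_0)
  \<comment> \<open>Half of the gap between \<open>u 0\<close> and the maximum of \<open>u\<close> on the sphere, so that the cone
    stays above \<open>u\<close> there.\<close>
  define \<epsilon> where "\<epsilon> = (u 0 - u y0) / (2 * r)"
  have \<epsilon>: "0 < \<epsilon>" using less[OF y0(1)] r by (simp add: \<epsilon>_def)
  have "continuous_on (cball 0 r) (\<lambda>y. u y + \<epsilon> * norm y)" by (intro continuous_intros cont)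
  from continuous_attains_sup[OF compact_cball _ this] r obtain z where
    z: "norm z \<le> r" "\<And>y. norm y \<le> r \<Longrightarrow> u y + \<epsilon> * norm y \<le> u z + \<epsilon> * norm z"
    by (metis cball_eq_empty mem_cball_0 not_less less_imp_le)
  have z0: "u 0 \<le> u z + \<epsilon> * norm z" using z(2)[of 0] r by simp
  consider "norm z = r" | "z \<noteq> 0" "norm z < r" | "z = 0" using z(1) by fastforce
  then show False
  proof cases
    case 1
    then have "u 0 \<le> u y0 + \<epsilon> * r" using z0 y0(2) by fastforce
    then show False using less[OF y0(1)] r by (simp add: \<epsilon>_def field_simps)
  next
    case 2
    let ?s = "z \<bullet> z"
    have s: "0 < ?s" using 2 by simp
    have n: "norm z = sqrt ?s" by (simp add: norm_eq_sqrt_inner)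
    \<comment> \<open>The cone as a function of the squared norm; in the trace bound its radial part cancels and
      the tangential part has the sign of \<open>- \<epsilon>\<close>.\<close>
    let ?\<psi> = "\<lambda>t. - \<epsilon> * sqrt t" and ?\<psi>1 = "\<lambda>t. - \<epsilon> / (2 * sqrt t)"
    have ev: "\<forall>\<^sub>F t in nhds ?s. (?\<psi> has_real_derivative ?\<psi>1 t) (at t)"
    proof (rule eventually_mono[OF eventually_nhds_in_open[OF open_greaterThan[of 0]]])
      fix t :: real assume "t \<in> {0<..}"
      then show "(?\<psi> has_real_derivative ?\<psi>1 t) (at t)"
        by (auto intro!: derivative_eq_intros simp: field_simps)
    qed (use s in simp)
    have "(?\<psi>1 has_real_derivative \<epsilon> / (4 * t * sqrt t)) (at t)" if "0 < t" for t
      using that by (auto intro!: derivative_eq_intros simp: field_simps)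
    from this[OF s] have d2: "(?\<psi>1 has_real_derivative \<epsilon> / (4 * ?s * sqrt ?s)) (at ?s)" .
    have mx: "\<forall>\<^sub>F y in nhds z. u y - ?\<psi> (y \<bullet> y) \<le> u z - ?\<psi> (z \<bullet> z)"
    proof (rule eventually_mono[OF eventually_nhds_in_open[OF open_ball[of 0 r]]])
      fix y :: "real^'n" assume "y \<in> ball 0 r"
      then show "u y - ?\<psi> (y \<bullet> y) \<le> u z - ?\<psi> (z \<bullet> z)"
        using z(2)[of y] by (simp add: norm_eq_sqrt_inner)
    qed (use 2 in simp)
    have "trace (D_field p u z) \<le> \<bar>2 * ?\<psi>1 ?s * norm z\<bar> powr (p - 2) *
      ((real CARD('n) - 1) * (2 * ?\<psi>1 ?s) + (p - 1) * (2 * ?\<psi>1 ?s + 4 * ?s * (\<epsilon> / (4 * ?s * sqrt ?s))))"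
      by (rule radial_touching(2)[OF 2(1) p u1 _ ev d2 _ mx])
        (use u 2 s \<epsilon> in \<open>auto simp: strictly_p_subharmonic_def\<close>)
    also have "2 * ?\<psi>1 ?s + 4 * ?s * (\<epsilon> / (4 * ?s * sqrt ?s)) = 0" using s by (simp add: field_simps)
    also have "\<bar>2 * ?\<psi>1 ?s * norm z\<bar> powr (p - 2) * ((real CARD('n) - 1) * (2 * ?\<psi>1 ?s) + (p - 1) * 0) \<le> 0"
      using \<epsilon> s by (intro mult_nonneg_nonpos) (auto intro!: mult_nonneg_nonpos divide_nonneg_pos simp: Suc_le_eq)
    finally show False using u 2 by (auto simp: strictly_p_subharmonic_def not_less[symmetric])
  next
    case 3
    obtain a :: "real^'n" where a: "norm a = 1" using vector_choose_size[of 1] by auto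
    have "grad u 0 = 0" by (rule grad_at_local_max[OF u1 \<rho>]) (simp add: max)
    then have "((\<lambda>t. u (0 + t *\<^sub>R a)) has_real_derivative 0) (at 0)"
      using grad_along_line[OF u1, where x = 0 and t = 0 and y = a] by simp
    then have "((\<lambda>t. u (0 + t *\<^sub>R a) + \<epsilon> * t) has_real_derivative \<epsilon>) (at 0)"
      by (auto intro!: derivative_eq_intros)
    from has_real_derivative_pos_inc_right[OF this \<epsilon>] obtain d where d: "0 < d"
      "\<And>t. 0 < t \<Longrightarrow> t < d \<Longrightarrow> u 0 < u (t *\<^sub>R a) + \<epsilon> * t" by auto
    define t where "t = min d r / 2"
    have "0 < t" "t < d" "t \<le> r" using d(1) r by (auto simp: t_def)
    with d(2)[of t] z(2)[of "t *\<^sub>R a"] 3 a show False by simp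
  qed
qed

text \<open>On the boundary sphere a maximum need not be critical, so criticality is assumed; in the comparison
  with a barrier that is flat up to the sphere it holds automatically.\<close>

lemma no_critical_max_on_ball:
  fixes u :: "real^'n \<Rightarrow> real"
  assumes u: "strictly_p_subharmonic p u" and p: "1 < p" and \<rho>: "0 < \<rho>"
    and x: "norm x \<le> \<rho>" and crit: "grad u x = 0"
    and max: "\<And>y. norm y \<le> \<rho> \<Longrightarrow> u y \<le> u x"
  shows False
proof (cases "x = 0")
  case True
  then show False using no_max_at_origin[OF u p \<rho>] max by simp
next
  case False
  then show False using no_critical_max_off_origin[OF u False crit] max x by force
qed

section \<open>Blow-up barriers\<close>

text \<open>The profile is - B log (1 - (\<theta> - 1)^(m + 1)) beyond 1. Near 1 the quantity b'' b'^(\<sigma> - 1) behaves like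
  (\<theta> - 1)^(m \<sigma> - 1), which is bounded if m \<sigma> is at least 1. Near 2 the left side of the differential
  inequality grows like (2 - \<theta>)^(- \<sigma> - 1) and exp (c b) like (2 - \<theta>)^(- c B), which match if
  c B = \<sigma> + 1.\<close>

lemma blow_up_profile:
  fixes \<sigma> c :: real
  assumes \<sigma>: "0 < \<sigma>" and c: "0 < c"
  obtains C :: real and b b1 b2 :: "real \<Rightarrow> real" where
    "0 < C" "\<And>\<theta>. \<theta> \<le> 1 \<Longrightarrow> b \<theta> = 0" "continuous_on {..<2} b"
    "\<And>\<theta>. 1 < \<theta> \<Longrightarrow> \<theta> < 2 \<Longrightarrow> (b has_real_derivative b1 \<theta>) (at \<theta>)"
    "\<And>\<theta>. 1 < \<theta> \<Longrightarrow> \<theta> < 2 \<Longrightarrow> (b1 has_real_derivative b2 \<theta>) (at \<theta>)"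
    "\<And>\<theta>. 1 < \<theta> \<Longrightarrow> \<theta> < 2 \<Longrightarrow> 0 < b1 \<theta>"
    "\<And>\<theta>. 1 < \<theta> \<Longrightarrow> \<theta> < 2 \<Longrightarrow> 0 \<le> b2 \<theta>"
    "\<And>\<theta>. 1 < \<theta> \<Longrightarrow> \<theta> < 2 \<Longrightarrow> b1 \<theta> powr \<sigma> + b2 \<theta> * b1 \<theta> powr (\<sigma> - 1) \<le> C * exp (c * b \<theta>)"
    "(b has_real_derivative 0) (at 1)"
    "\<And>K. \<exists>\<theta>. 1 < \<theta> \<and> \<theta> < 2 \<and> K < b \<theta>"
proof -
  obtain m :: nat where m: "1 / \<sigma> + 1 < real m" using reals_Archimedean2 by blast
  have m1: "1 \<le> m" using m \<sigma> by (cases m) (auto simp: field_simps)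
  have m\<sigma>: "1 \<le> real m * \<sigma>"
  proof -
    have "1 / \<sigma> * \<sigma> \<le> real m * \<sigma>" using m \<sigma> by (intro mult_right_mono) auto
    then show ?thesis using \<sigma> by simp
  qed
  define N where "N = Suc m"
  define B where "B = (\<sigma> + 1) / c"
  have B: "0 < B" using \<sigma> c by (simp add: B_def)
  define D where "D \<theta> = 1 - (\<theta> - 1) ^ N" for \<theta> :: real
  define b where "b \<theta> = (if \<theta> \<le> 1 then 0 else - B * ln (D \<theta>))" for \<theta>
  define b1 where "b1 \<theta> = B * real N * (\<theta> - 1) ^ m / D \<theta>" for \<theta>
  define b2 where "b2 \<theta> = b1 \<theta> * (real m / (\<theta> - 1) + real N * (\<theta> - 1) ^ m / D \<theta>)" for \<theta>
  define C where "C = (B * real N) powr \<sigma> * (2 * real N)"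
  have D: "0 < D \<theta>" "D \<theta> < 1" if "1 < \<theta>" "\<theta> < 2" for \<theta>
    using that power_Suc_less_one[of "\<theta> - 1" m] by (auto simp: D_def N_def)
  have dD: "(D has_real_derivative - (real N * (\<theta> - 1) ^ m)) (at \<theta>)" for \<theta>
  proof -
    have "N - Suc 0 = m" by (simp add: N_def)
    then show ?thesis unfolding D_def [abs_def] by (auto intro!: derivative_eq_intros)
  qed
  have ln_deriv: "((\<lambda>\<theta>. - B * ln (D \<theta>)) has_real_derivative b1 \<theta>) (at \<theta>)" if "0 < D \<theta>" for \<theta>
    by (rule derivative_eq_intros dD that refl)+ (simp add: b1_def field_simps)
  have b_deriv: "(b has_real_derivative b1 \<theta>) (at \<theta>)" if "1 < \<theta>" "\<theta> < 2" for \<theta>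
  proof (rule has_field_derivative_transform_within_open[OF ln_deriv])
    show "0 < D \<theta>" using D that by simp
    show "- B * ln (D x) = b x" if "x \<in> {1<..}" for x using that by (simp add: b_def)
  qed (use that in auto)
  have pos: "0 < b1 \<theta>" if "1 < \<theta>" "\<theta> < 2" for \<theta>
    using D[OF that] B that by (simp add: b1_def N_def)
  have b1_deriv: "(b1 has_real_derivative b2 \<theta>) (at \<theta>)" if \<theta>: "1 < \<theta>" "\<theta> < 2" for \<theta>
  proof -
    have mm: "real m * (\<theta> - 1) ^ (m - 1) = real m / (\<theta> - 1) * (\<theta> - 1) ^ m"
      using m1 \<theta> by (cases m) auto
    have "((\<lambda>\<theta>. B * real N * (\<theta> - 1) ^ m) has_real_derivative B * real N * (real m * (\<theta> - 1) ^ (m - 1))) (at \<theta>)"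
      by (auto intro!: derivative_eq_intros)
    from DERIV_divide[OF this dD] D[OF \<theta>]
    have "((\<lambda>\<theta>. B * real N * (\<theta> - 1) ^ m / D \<theta>) has_real_derivative
      (B * real N * (real m * (\<theta> - 1) ^ (m - 1)) * D \<theta> - B * real N * (\<theta> - 1) ^ m * - (real N * (\<theta> - 1) ^ m)) / (D \<theta> * D \<theta>)) (at \<theta>)"
      by simp
    also have "(B * real N * (real m * (\<theta> - 1) ^ (m - 1)) * D \<theta> - B * real N * (\<theta> - 1) ^ m * - (real N * (\<theta> - 1) ^ m)) / (D \<theta> * D \<theta>) = b2 \<theta>"
      unfolding mm b2_def b1_def using D[OF \<theta>] by (simp add: add_divide_distrib distrib_left mult_ac)
    finally show ?thesis unfolding b1_def [abs_def] .
  qed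
  have b2_nonneg: "0 \<le> b2 \<theta>" if "1 < \<theta>" "\<theta> < 2" for \<theta>
    using D[OF that] pos[OF that] that by (simp add: b2_def)
  have bound: "b1 \<theta> powr \<sigma> + b2 \<theta> * b1 \<theta> powr (\<sigma> - 1) \<le> C * exp (c * b \<theta>)" if \<theta>: "1 < \<theta>" "\<theta> < 2" for \<theta>
  proof -
    define \<tau> where "\<tau> = \<theta> - 1"
    have \<tau>: "0 < \<tau>" "\<tau> < 1" using \<theta> by (auto simp: \<tau>_def)
    note D' = D[OF \<theta>] and p' = pos[OF \<theta>]
    let ?E = "(B * real N) powr \<sigma> * D \<theta> powr (- \<sigma> - 1)"
    have E: "(B * real N) powr \<sigma> * D \<theta> powr (- \<sigma>) = ?E * D \<theta>"
      using D' by (simp add: powr_diff)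
    have tm: "(\<tau> ^ m) powr \<sigma> = \<tau> powr (real m * \<sigma>)" using \<tau> by (simp add: powr_realpow[symmetric] powr_powr)
    have b1s: "b1 \<theta> powr \<sigma> = ?E * D \<theta> * \<tau> powr (real m * \<sigma>)"
    proof -
      have "b1 \<theta> powr \<sigma> = (B * real N) powr \<sigma> * (\<tau> ^ m) powr \<sigma> / D \<theta> powr \<sigma>"
        using \<tau> B D' by (simp add: b1_def \<tau>_def[symmetric] powr_mult powr_divide)
      also have "\<dots> = ((B * real N) powr \<sigma> * D \<theta> powr (- \<sigma>)) * \<tau> powr (real m * \<sigma>)"
        unfolding tm by (simp add: powr_minus divide_inverse)
      finally show ?thesis unfolding E .
    qed
    have "\<tau> powr (real m * \<sigma>) \<le> \<tau> powr 1" using \<tau> m\<sigma> by (intro powr_mono') auto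
    then have t1: "\<tau> powr (real m * \<sigma>) \<le> \<tau>" using \<tau> by simp
    have tm1: "\<tau> ^ m \<le> 1" using \<tau> by (intro power_le_one) auto
    have "b1 \<theta> powr \<sigma> + b2 \<theta> * b1 \<theta> powr (\<sigma> - 1) = b1 \<theta> powr \<sigma> * (1 + real m / \<tau> + real N * \<tau> ^ m / D \<theta>)"
      using p' by (simp add: b2_def \<tau>_def[symmetric] powr_diff field_simps)
    also have "\<dots> = ?E * (\<tau> powr (real m * \<sigma>) * (D \<theta> + real m * D \<theta> / \<tau> + real N * \<tau> ^ m))"
      unfolding b1s using D' \<tau> by (simp add: field_simps)
    also have "\<dots> \<le> ?E * (\<tau> * (1 + real m * 1 / \<tau> + real N * 1))"
      using D' \<tau> B t1 tm1
      by (intro mult_left_mono mult_mono add_mono divide_right_mono) auto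
    also have "\<tau> * (1 + real m * 1 / \<tau> + real N * 1) = \<tau> * (1 + real N) + real m" using \<tau> by (simp add: field_simps)
    also have "\<dots> \<le> 1 * (1 + real N) + real m" using \<tau> by (intro add_right_mono mult_right_mono) auto
    also have "\<dots> = 2 * real N" by (simp add: N_def)
    finally have "b1 \<theta> powr \<sigma> + b2 \<theta> * b1 \<theta> powr (\<sigma> - 1) \<le> ?E * (2 * real N)"
      using D' by (simp add: mult_left_mono)
    also have "D \<theta> powr (- \<sigma> - 1) = exp (c * b \<theta>)"
      using D' \<theta> c by (simp add: powr_def b_def B_def field_simps)
    finally show ?thesis by (simp add: C_def mult_ac)
  qed
  \<comment> \<open>The two pieces of \<open>b\<close> meet at 1 with the same value and the same derivative 0.\<close>
  have D1: "0 < D 1" by (simp add: D_def N_def)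
  have b1_1: "b1 1 = 0" using m1 by (simp add: b1_def)
  have "b = (\<lambda>\<theta>. if \<theta> \<in> {..1} then 0 else - B * ln (D \<theta>))" by (simp add: b_def fun_eq_iff)
  moreover have "((\<lambda>\<theta>. if \<theta> \<in> {..1} then 0 else - B * ln (D \<theta>)) has_vector_derivative (if 1 \<in> {..1::real} then 0 else b1 1)) (at 1 within {..1} \<union> {1..})"
    by (rule has_vector_derivative_If_within_closures)
      (use ln_deriv[OF D1] b1_1 in \<open>auto simp: has_real_derivative_iff_has_vector_derivative D_def N_def intro: has_vector_derivative_at_within\<close>)
  moreover have "{..1} \<union> {1::real..} = UNIV" by auto
  ultimately have at1: "(b has_real_derivative 0) (at 1)"
    by (simp add: has_real_derivative_iff_has_vector_derivative)
  have "isCont b \<theta>" if "\<theta> < 2" for \<theta>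
  proof -
    consider "\<theta> < 1" | "\<theta> = 1" | "1 < \<theta>" by linarith
    then show ?thesis
    proof cases
      case 1
      have "(b has_real_derivative 0) (at \<theta>)"
        by (rule has_field_derivative_transform_within_open[of "\<lambda>_. 0" _ _ "{..<1}"]) (use 1 in \<open>auto simp: b_def\<close>)
      then show ?thesis by (rule DERIV_isCont)
    qed (use that at1 b_deriv DERIV_isCont in blast)+
  qed
  then have cont: "continuous_on {..<2} b" by (intro continuous_at_imp_continuous_on) auto
  have unbounded: "\<exists>\<theta>. 1 < \<theta> \<and> \<theta> < 2 \<and> K < b \<theta>" for K
  proof -
    define z where "z = exp (- (\<bar>K\<bar> + 1) / B)"
    have z: "0 < z" "z < 1" using B by (auto simp: z_def intro!: divide_neg_pos)
    define \<tau> where "\<tau> = root N (1 - z)"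
    have N: "0 < N" by (simp add: N_def)
    have \<tau>: "0 < \<tau>" "\<tau> < 1" "\<tau> ^ N = 1 - z" using z N by (auto simp: \<tau>_def)
    have "b (1 + \<tau>) = \<bar>K\<bar> + 1" using \<tau> B by (simp add: b_def D_def z_def)
    then show ?thesis using \<tau> by (intro exI[of _ "1 + \<tau>"]) auto
  qed
  have "0 < C" using B by (simp add: C_def N_def)
  from that[of C b b1 b2, OF this _ cont b_deriv b1_deriv pos b2_nonneg bound at1 unbounded]
  show thesis by (simp add: b_def)
qed

section \<open>Non-existence\<close>

text \<open>If u(0) \<ge> L, let \<open>z\<close> be a maximum point of u(x) - b(\<mu> |x|^2) on a ball at whose boundary \<open>b\<close> is so
  large that \<open>z\<close> is interior. With \<theta> = \<mu> |z|^2 \<le> 1 the function \<open>u\<close> would have a critical maximum on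
  the ball where \<open>b\<close> is flat. Otherwise |Du(z)| = 2 \<mu> b'(\<theta>) |z| with |z|^2 = \<theta> / \<mu>, and the
  inequality for u at \<open>z\<close> turns into the one for the profile, multiplied by \<mu>^((p - \<beta> + \<alpha>)/2); the
  remaining powers of \<theta> are bounded since 1 < \<theta> < 2.\<close>

lemma below_barrier:
  fixes p \<alpha> \<beta> c K :: real
  assumes p: "1 < p" and \<beta>: "\<beta> < p - 1" and c: "0 < c" and K: "0 < K"
  obtains C where "0 < C" "\<And>(u :: real^'n \<Rightarrow> real) \<mu> L. strictly_p_subharmonic p u \<Longrightarrow>
    (\<And>x. x \<noteq> 0 \<Longrightarrow> norm x powr \<alpha> * rpow (norm (grad u x)) \<beta> * exp (c * u x) \<le> K * trace (D_field p u x)) \<Longrightarrow>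
    0 < \<mu> \<Longrightarrow> C * \<mu> powr ((p - \<beta> + \<alpha>) / 2) < exp (c * L) \<Longrightarrow> u 0 < L"
proof -
  define \<sigma> where "\<sigma> = p - 1 - \<beta>"
  have \<sigma>: "0 < \<sigma>" using \<beta> by (simp add: \<sigma>_def)
  obtain b b1 b2 :: "real \<Rightarrow> real" and C0 :: real where C0: "0 < C0"
    and flat: "\<And>\<theta>. \<theta> \<le> 1 \<Longrightarrow> b \<theta> = 0" and cont: "continuous_on {..<2} b"
    and d1: "\<And>\<theta>. 1 < \<theta> \<Longrightarrow> \<theta> < 2 \<Longrightarrow> (b has_real_derivative b1 \<theta>) (at \<theta>)"
    and d2: "\<And>\<theta>. 1 < \<theta> \<Longrightarrow> \<theta> < 2 \<Longrightarrow> (b1 has_real_derivative b2 \<theta>) (at \<theta>)"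
    and pos: "\<And>\<theta>. 1 < \<theta> \<Longrightarrow> \<theta> < 2 \<Longrightarrow> 0 < b1 \<theta>"
    and b2: "\<And>\<theta>. 1 < \<theta> \<Longrightarrow> \<theta> < 2 \<Longrightarrow> 0 \<le> b2 \<theta>"
    and bound: "\<And>\<theta>. 1 < \<theta> \<Longrightarrow> \<theta> < 2 \<Longrightarrow> b1 \<theta> powr \<sigma> + b2 \<theta> * b1 \<theta> powr (\<sigma> - 1) \<le> C0 * exp (c * b \<theta>)"
    and at1: "(b has_real_derivative 0) (at 1)"
    and unb: "\<And>K. \<exists>\<theta>. 1 < \<theta> \<and> \<theta> < 2 \<and> K < b \<theta>"
    by (rule blow_up_profile[OF \<sigma> c]) (rule that; (assumption | blast))
  define n where "n = real CARD('n)"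
  have n: "1 \<le> n" by (simp add: n_def Suc_le_eq)
  \<comment> \<open>Bounds the powers of \<open>\<theta>\<close> and the numerical coefficients that remain for 1 < \<theta> < 2.\<close>
  define T where "T = 2 powr (\<sigma> - 1) * 2 powr \<bar>(\<sigma> - 1 - \<alpha>) / 2\<bar> * (2 * n + 8 * p)"
  have T: "0 < T" using n p by (simp add: T_def)
  have key: "u 0 < L"
    if u: "strictly_p_subharmonic p u"
      and ineq: "\<And>x. x \<noteq> 0 \<Longrightarrow> norm x powr \<alpha> * rpow (norm (grad u x)) \<beta> * exp (c * u x) \<le> K * trace (D_field p u x)"
      and \<mu>: "0 < \<mu>" and L: "K * T * C0 * \<mu> powr ((p - \<beta> + \<alpha>) / 2) < exp (c * L)"
    for u :: "real^'n \<Rightarrow> real" and \<mu> L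
  proof (rule ccontr)
    assume "\<not> u 0 < L"
    have u1: "u differentiable (at y)" for y using u by (simp add: strictly_p_subharmonic_def)
    have cont_u: "continuous_on X u" for X
      by (intro continuous_at_imp_continuous_on ballI differentiable_imp_continuous_within u1)
    let ?w = "\<lambda>x::real^'n. b (\<mu> * (x \<bullet> x))"
    have "bdd_above (u ` cball 0 (sqrt (2 / \<mu>)))"
      by (intro bounded_imp_bdd_above compact_imp_bounded compact_continuous_image cont_u compact_cball)
    then obtain M where "\<forall>v\<in>u ` cball 0 (sqrt (2 / \<mu>)). v \<le> M" unfolding bdd_above_def by blast
    then have M: "u y \<le> M" if "norm y \<le> sqrt (2 / \<mu>)" for y using that by auto
    obtain \<theta>1 where \<theta>1: "1 < \<theta>1" "\<theta>1 < 2" "M - u 0 < b \<theta>1" using unb by blast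
    define R where "R = sqrt (\<theta>1 / \<mu>)"
    have R: "0 < R" "R \<le> sqrt (2 / \<mu>)" using \<theta>1 \<mu> by (auto simp: R_def divide_right_mono)
    have norm_iff: "norm y \<le> sqrt (t / \<mu>) \<longleftrightarrow> \<mu> * (y \<bullet> y) \<le> t" "norm y < sqrt (t / \<mu>) \<longleftrightarrow> \<mu> * (y \<bullet> y) < t" for y :: "real^'n" and t
      using \<mu> by (simp_all add: norm_eq_sqrt_inner pos_le_divide_eq pos_less_divide_eq mult.commute)
    have "continuous_on (cball 0 R) (\<lambda>x. u x - ?w x)"
    proof (rule continuous_on_diff[OF cont_u], rule continuous_on_compose2[OF cont])
      show "continuous_on (cball 0 R) (\<lambda>x::real^'n. \<mu> * (x \<bullet> x))" by (intro continuous_intros)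
      show "(\<lambda>x::real^'n. \<mu> * (x \<bullet> x)) ` cball 0 R \<subseteq> {..<2}"
      proof (rule image_subsetI)
        fix y :: "real^'n" assume "y \<in> cball 0 R"
        then have "\<mu> * (y \<bullet> y) \<le> \<theta>1" using norm_iff(1)[of y \<theta>1] by (simp add: R_def)
        then show "\<mu> * (y \<bullet> y) \<in> {..<2}" using \<theta>1 by simp
      qed
    qed
    from continuous_attains_sup[OF compact_cball _ this] R obtain z where
      z: "norm z \<le> R" "\<And>y. norm y \<le> R \<Longrightarrow> u y - ?w y \<le> u z - ?w z"
      by (metis cball_eq_empty mem_cball_0 not_less less_imp_le)
    have z0: "u 0 \<le> u z - ?w z" using z(2)[of 0] R flat[of 0] by simp
    let ?\<theta> = "\<mu> * (z \<bullet> z)"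
    have \<theta>lt: "?\<theta> < \<theta>1"
    proof (rule ccontr)
      assume "\<not> ?\<theta> < \<theta>1"
      then have "?\<theta> = \<theta>1" using z(1) norm_iff(1)[of z \<theta>1] by (simp add: R_def)
      then show False using z0 M[of z] z(1) R(2) \<theta>1(3) by simp
    qed
    then have zR: "norm z < R" using norm_iff(2) by (simp add: R_def)
    have max: "\<forall>\<^sub>F y in nhds z. u y - ?w y \<le> u z - ?w z"
    proof (rule eventually_mono[OF eventually_nhds_in_open[OF open_ball[of 0 R]]])
      show "u y - ?w y \<le> u z - ?w z" if "y \<in> ball 0 R" for y using z(2)[of y] that by simp
    qed (use zR in simp)
    show False
    proof (cases "?\<theta> \<le> 1")
      case True
      have le: "norm z \<le> sqrt (1 / \<mu>)" using True norm_iff(1)[of z 1] by simp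
      have flat_max: "u y \<le> u z" if "norm y \<le> sqrt (1 / \<mu>)" for y
      proof -
        have "\<mu> * (y \<bullet> y) \<le> 1" using that norm_iff(1)[of y 1] by simp
        moreover from this have "norm y \<le> R" using norm_iff(1)[of y \<theta>1] \<theta>1 by (simp add: R_def)
        ultimately show ?thesis using z(2)[of y] flat True by simp
      qed
      have "(b has_real_derivative 0) (at ?\<theta>)"
      proof (cases "?\<theta> = 1")
        case False
        with True have lt: "?\<theta> < 1" by simp
        show ?thesis
          by (rule has_field_derivative_transform_within_open[of "\<lambda>_. 0" _ _ "{..<1}"]) (use lt in \<open>auto simp: flat\<close>)
      qed (use at1 in simp)
      then have b0: "(b has_derivative ((*) 0)) (at ?\<theta>)" by (simp add: has_field_derivative_def)
      have q: "((\<lambda>x. \<mu> * (x \<bullet> x)) has_derivative (\<lambda>h. \<mu> * (2 * (z \<bullet> h)))) (at z)"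
        by (auto intro!: derivative_eq_intros simp: inner_commute)
      have dz: "((\<lambda>x. u x - ?w x) has_derivative (\<lambda>h. grad u z \<bullet> h)) (at z)"
        using has_derivative_diff[OF has_derivative_grad[OF u1] has_derivative_compose[OF q b0]] by simp
      have "grad (\<lambda>x. u x - ?w x) z = 0"
      proof (rule grad_at_local_max)
        show "(\<lambda>x. u x - ?w x) differentiable (at z)" using dz by (rule differentiableI)
        show "u y - ?w y \<le> u z - ?w z" if "dist z y < R - norm z" for y
        proof (rule z(2))
          show "norm y \<le> R" using that norm_triangle_sub[of y z] by (simp add: dist_norm norm_minus_commute)
        qed
      qed (use zR in simp)
      then have "grad u z = 0" using grad_eqI[OF dz] by simp
      then show False using no_critical_max_on_ball[OF u p _ le _ flat_max] \<mu> by simp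
    next
      case False
      then have \<theta>: "1 < ?\<theta>" "?\<theta> < 2" using \<theta>lt \<theta>1 by auto
      have znz: "z \<noteq> 0" using \<theta> by auto
      define B1 B2 where "B1 = b1 ?\<theta>" and "B2 = b2 ?\<theta>"
      have B: "0 < B1" "0 \<le> B2" using pos b2 \<theta> by (auto simp: B1_def B2_def)
      let ?\<psi> = "\<lambda>t. b (\<mu> * t)" and ?\<psi>1 = "\<lambda>t. \<mu> * b1 (\<mu> * t)"
      have chain: "((\<lambda>t. g (\<mu> * t)) has_real_derivative g' * \<mu>) (at t)"
        if "(g has_real_derivative g') (at (\<mu> * t))" for g g' and t :: real
        by (rule DERIV_chain2[of g g' "\<lambda>t. \<mu> * t" t \<mu> UNIV]) (auto intro!: that derivative_eq_intros)
      have ev: "\<forall>\<^sub>F t in nhds (z \<bullet> z). (?\<psi> has_real_derivative ?\<psi>1 t) (at t)"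
      proof (rule eventually_mono[OF eventually_nhds_in_open[OF open_greaterThanLessThan[of "1/\<mu>" "2/\<mu>"]]])
        fix t assume "t \<in> {1/\<mu><..<2/\<mu>}"
        then have "1 < \<mu> * t" "\<mu> * t < 2" using \<mu> by (auto simp: field_simps)
        from chain[OF d1[OF this]] show "(?\<psi> has_real_derivative ?\<psi>1 t) (at t)" by (simp add: mult.commute)
      qed (use \<theta> \<mu> in \<open>simp add: field_simps\<close>)
      have dd: "(?\<psi>1 has_real_derivative \<mu> * (B2 * \<mu>)) (at (z \<bullet> z))"
        unfolding B2_def by (intro DERIV_cmult chain d2 \<theta>)
      have u2: "grad u differentiable (at z)" using u znz by (simp add: strictly_p_subharmonic_def)
      note touch = radial_touching[OF znz p u1 u2 ev dd _ max, folded B1_def]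
      define G where "G = 2 * (\<mu> * B1) * norm z"
      have G: "0 < G" using \<mu> B znz by (simp add: G_def)
      have grad_norm: "norm (grad u z) = G"
        using touch(1) \<mu> B by (simp add: G_def)
      define S where "S = (n - 1) * (2 * B1) + (p - 1) * (2 * B1 + 4 * ?\<theta> * B2)"
      have "trace (D_field p u z) \<le> G powr (p - 2) * (\<mu> * S)"
        using touch(2) \<mu> B G by (simp add: G_def S_def n_def algebra_simps)
      then have "K * trace (D_field p u z) \<le> K * (G powr (p - 2) * (\<mu> * S))"
        using K by (intro mult_left_mono) auto
      moreover have "rpow G \<beta> = G powr \<beta>" using G by (simp add: rpow_def)
      ultimately have "norm z powr \<alpha> * G powr \<beta> * exp (c * u z) \<le> K * (G powr (p - 2) * (\<mu> * S))"
        using ineq[OF znz] unfolding grad_norm by simp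
      moreover have "G powr (p - 2) = G powr (\<sigma> - 1) * G powr \<beta>"
        by (simp add: \<sigma>_def powr_add[symmetric])
      ultimately have "(norm z powr \<alpha> * exp (c * u z)) * G powr \<beta> \<le> (K * (G powr (\<sigma> - 1) * (\<mu> * S))) * G powr \<beta>"
        by (simp add: mult_ac)
      then have "norm z powr \<alpha> * exp (c * u z) \<le> K * (G powr (\<sigma> - 1) * (\<mu> * S))"
        by (rule mult_right_le_imp_le) (use G in simp)
      moreover have "norm z powr \<alpha> * exp (c * (L + b ?\<theta>)) \<le> norm z powr \<alpha> * exp (c * u z)"
        using c z0 \<open>\<not> u 0 < L\<close> by (intro mult_left_mono) auto
      ultimately have 1: "norm z powr \<alpha> * exp (c * (L + b ?\<theta>)) \<le> K * (G powr (\<sigma> - 1) * (\<mu> * S))" by linarith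
      have nz: "norm z = (?\<theta> / \<mu>) powr (1/2)" using \<mu> by (simp add: norm_eq_sqrt_inner powr_half_sqrt)
      have za: "norm z powr \<alpha> = ?\<theta> powr (\<alpha>/2) * \<mu> powr (- \<alpha>/2)"
      proof -
        have "((t / \<mu>) powr (1/2)) powr \<alpha> = t powr (\<alpha>/2) * \<mu> powr (- \<alpha>/2)" if "0 < t" for t
          using \<mu> that by (simp add: powr_powr powr_divide powr_minus_divide)
        then show ?thesis unfolding nz by this (use \<theta> in linarith)
      qed
      have Gs: "G powr (\<sigma> - 1) = 2 powr (\<sigma> - 1) * \<mu> powr ((\<sigma> - 1)/2) * ?\<theta> powr ((\<sigma> - 1)/2) * B1 powr (\<sigma> - 1)"
      proof -
        have "(2 * (\<mu> * B1) * (t / \<mu>) powr (1/2)) powr (\<sigma> - 1)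
            = 2 powr (\<sigma> - 1) * \<mu> powr ((\<sigma> - 1)/2) * t powr ((\<sigma> - 1)/2) * B1 powr (\<sigma> - 1)" if "0 < t" for t
        proof -
          have "\<mu> = \<mu> powr (1/2) * \<mu> powr (1/2)" using \<mu> by (simp add: powr_add[symmetric])
          then have eq: "2 * (\<mu> * B1) * (t / \<mu>) powr (1/2) = 2 * \<mu> powr (1/2) * t powr (1/2) * B1"
            using \<mu> that by (simp add: powr_divide field_simps)
          show ?thesis unfolding eq using \<mu> that B by (simp add: powr_mult powr_powr)
        qed
        then show ?thesis unfolding G_def nz by this (use \<theta> in linarith)
      qed
      define Y where "Y = B1 powr \<sigma> + B2 * B1 powr (\<sigma> - 1)"
      have Y: "Y \<le> C0 * exp (c * b ?\<theta>)" "0 \<le> Y" using bound[OF \<theta>] B by (auto simp: Y_def B1_def B2_def)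
      have SY: "B1 powr (\<sigma> - 1) * S \<le> (2 * n + 8 * p) * Y"
      proof -
        have "S = (2 * (n - 1) + 2 * (p - 1)) * B1 + 4 * (p - 1) * ?\<theta> * B2" by (simp add: S_def algebra_simps)
        also have "\<dots> \<le> (2 * n + 8 * p) * B1 + (2 * n + 8 * p) * B2"
        proof (intro add_mono mult_right_mono)
          have "4 * (p - 1) * ?\<theta> \<le> 4 * (p - 1) * 2" using \<theta> p by (intro mult_left_mono) auto
          then show "4 * (p - 1) * ?\<theta> \<le> 2 * n + 8 * p" using n by simp
        qed (use B n p in auto)
        finally have "B1 powr (\<sigma> - 1) * S \<le> B1 powr (\<sigma> - 1) * ((2 * n + 8 * p) * B1 + (2 * n + 8 * p) * B2)"
          by (intro mult_left_mono) auto
        also have "\<dots> = (2 * n + 8 * p) * Y"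
          using B by (simp add: Y_def powr_diff field_simps)
        finally show ?thesis .
      qed
      have \<theta>e: "?\<theta> powr ((\<sigma> - 1)/2) * ?\<theta> powr (- \<alpha>/2) \<le> 2 powr \<bar>(\<sigma> - 1 - \<alpha>) / 2\<bar>"
      proof -
        have "?\<theta> powr ((\<sigma> - 1)/2) * ?\<theta> powr (- \<alpha>/2) = ?\<theta> powr ((\<sigma> - 1 - \<alpha>)/2)"
          by (simp add: powr_add[symmetric] diff_divide_distrib)
        also have "\<dots> \<le> ?\<theta> powr \<bar>(\<sigma> - 1 - \<alpha>)/2\<bar>" using \<theta> by (intro powr_mono abs_ge_self) linarith
        also have "\<dots> \<le> 2 powr \<bar>(\<sigma> - 1 - \<alpha>)/2\<bar>" using \<theta> by (intro powr_mono2) auto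
        finally show ?thesis .
      qed
      have \<mu>e: "\<mu> powr (\<alpha>/2) * (\<mu> powr ((\<sigma> - 1)/2) * \<mu>) = \<mu> powr ((p - \<beta> + \<alpha>) / 2)"
      proof -
        have "\<mu> powr (\<alpha>/2) * (\<mu> powr ((\<sigma> - 1)/2) * \<mu> powr 1) = \<mu> powr (\<alpha>/2 + ((\<sigma> - 1)/2 + 1))"
          by (simp only: powr_add)
        also have "\<alpha>/2 + ((\<sigma> - 1)/2 + 1) = (p - \<beta> + \<alpha>) / 2" by (simp add: \<sigma>_def field_simps)
        finally show ?thesis using \<mu> by simp
      qed
      have cancel: "?\<theta> powr (\<alpha>/2) * ?\<theta> powr (- \<alpha>/2) = 1" "\<mu> powr (- \<alpha>/2) * \<mu> powr (\<alpha>/2) = 1"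
        using \<mu> znz by (simp_all add: powr_add[symmetric])
      have "exp (c * L) * exp (c * b ?\<theta>) = (?\<theta> powr (\<alpha>/2) * ?\<theta> powr (- \<alpha>/2)) *
          (\<mu> powr (- \<alpha>/2) * \<mu> powr (\<alpha>/2)) * exp (c * (L + b ?\<theta>))"
        unfolding cancel by (simp add: exp_add distrib_left)
      also have "\<dots> = ?\<theta> powr (- \<alpha>/2) * \<mu> powr (\<alpha>/2) * (norm z powr \<alpha> * exp (c * (L + b ?\<theta>)))"
        unfolding za by (simp only: mult_ac)
      also have "\<dots> \<le> ?\<theta> powr (- \<alpha>/2) * \<mu> powr (\<alpha>/2) * (K * (G powr (\<sigma> - 1) * (\<mu> * S)))"
        by (intro mult_left_mono 1) auto
      also have "\<dots> = K * (\<mu> powr (\<alpha>/2) * (\<mu> powr ((\<sigma> - 1)/2) * \<mu>)) *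
          (2 powr (\<sigma> - 1) * (?\<theta> powr ((\<sigma> - 1)/2) * ?\<theta> powr (- \<alpha>/2)) * (B1 powr (\<sigma> - 1) * S))"
        unfolding Gs by (simp add: mult_ac)
      also have "\<dots> \<le> K * \<mu> powr ((p - \<beta> + \<alpha>) / 2) *
          (2 powr (\<sigma> - 1) * 2 powr \<bar>(\<sigma> - 1 - \<alpha>) / 2\<bar> * ((2 * n + 8 * p) * Y))"
        unfolding \<mu>e
      proof (rule mult_left_mono[OF mult_mono[OF mult_left_mono[OF \<theta>e] SY]])
        show "0 \<le> B1 powr (\<sigma> - 1) * S" using B n p \<theta> by (simp add: S_def)
      qed (use K in auto)
      also have "\<dots> = K * \<mu> powr ((p - \<beta> + \<alpha>) / 2) * T * Y" by (simp add: T_def mult_ac)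
      also have "\<dots> \<le> K * \<mu> powr ((p - \<beta> + \<alpha>) / 2) * T * (C0 * exp (c * b ?\<theta>))"
        using K T by (intro mult_left_mono Y) auto
      finally have "exp (c * L) * exp (c * b ?\<theta>) \<le> (K * T * C0 * \<mu> powr ((p - \<beta> + \<alpha>) / 2)) * exp (c * b ?\<theta>)"
        by (simp add: mult_ac)
      then show False using L by simp
    qed
  qed
  show thesis by (rule that[of "K * T * C0"]) (use K T C0 key in auto)
qed

text \<open>The admissible \<mu> are arbitrarily small and p - \<beta> + \<alpha> > 0, so the preceding lemma applies even
  with L = u(0).\<close>

lemma no_entire_exponential_subsolution:
  fixes u :: "real^'n \<Rightarrow> real"
  assumes p: "1 < p" and \<beta>: "\<beta> < p - 1" and \<alpha>: "-1 < \<alpha>" and c: "0 < c" and K: "0 < K"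
    and u: "strictly_p_subharmonic p u"
    and ineq: "\<And>x. x \<noteq> 0 \<Longrightarrow> norm x powr \<alpha> * rpow (norm (grad u x)) \<beta> * exp (c * u x) \<le> K * trace (D_field p u x)"
  shows False
proof -
  obtain C where C: "0 < C" "\<And>\<mu> L. 0 < \<mu> \<Longrightarrow> C * \<mu> powr ((p - \<beta> + \<alpha>) / 2) < exp (c * L) \<Longrightarrow> u 0 < L"
    using below_barrier[OF p \<beta> c K, of \<alpha>] u ineq by metis
  define \<kappa> where "\<kappa> = (p - \<beta> + \<alpha>) / 2"
  have \<kappa>: "0 < \<kappa>" using \<beta> \<alpha> by (simp add: \<kappa>_def)
  \<comment> \<open>The scale is \<mu> = exp z, with z so small that C \<mu>^\<kappa> = exp (c u(0) - 1).\<close>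
  define z where "z = (c * u 0 - ln C - 1) / \<kappa>"
  have "C * exp z powr \<kappa> = exp (ln C + z * \<kappa>)" using C(1) by (simp add: powr_def exp_add mult.commute)
  also have "\<dots> < exp (c * u 0)" using \<kappa> by (simp add: z_def)
  finally show False using C(2)[of "exp z" "u 0"] by (simp add: \<kappa>_def)
qed

section \<open>Rank-one perturbations of multiples of the identity\<close>

text \<open>An orthogonal matrix that takes a coordinate axis to \<open>e\<close> diagonalizes \<open>M\<close>.\<close>

lemma has_eigenvalues_rank_one:
  fixes e :: "real^'n"
  assumes e: "norm e = 1"
    and M: "\<And>h. M *v h = a *\<^sub>R h + (b * (e \<bullet> h)) *\<^sub>R e"
  obtains k where "has_eigenvalues M (\<chi> i. if i = k then a + b else a)"
proof -
  fix k :: 'n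
  obtain R :: "real^'n^'n" where R: "orthogonal_matrix R" "R *v axis k 1 = e"
    using orthogonal_matrix_exists_basis[OF e] by blast
  define l :: "real^'n" where "l = (\<chi> i. if i = k then a + b else a)"
  have inner: "(R *v x) \<bullet> (R *v y) = x \<bullet> y" for x y
  proof -
    have "(R *v x) \<bullet> (R *v y) = x \<bullet> ((transpose R ** R) *v y)"
      by (simp add: matrix_vector_mul_assoc[symmetric] inner_vector_matrix_mult)
    then show ?thesis using R(1) by (simp add: orthogonal_matrix)
  qed
  have "det (mat t - M) = (\<Prod>i\<in>UNIV. t - l $ i)" for t
  proof -
    let ?N = "transpose R ** (mat t - M) ** R"
    have N: "?N $ i $ j = (if i = j then t - l $ i else 0)" for i j
    proof -
      have tv: "mat t *v v = t *\<^sub>R v" for v :: "real^'n"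
        by (simp add: vec_eq_iff matrix_vector_mult_def mat_def if_distrib[of "\<lambda>a. a * _"] cong: if_cong)
      have "?N $ i $ j = axis i 1 \<bullet> (?N *v axis j 1)"
        by (simp add: inner_axis' matrix_vector_mult_basis column_def)
      also have "\<dots> = (R *v axis i 1) \<bullet> ((mat t - M) *v (R *v axis j 1))"
        by (simp add: matrix_vector_mul_assoc[symmetric] inner_vector_matrix_mult)
      also have "\<dots> = (t - a) * (axis i (1::real) \<bullet> axis j 1) - b * (axis k (1::real) \<bullet> axis j 1) * (axis i (1::real) \<bullet> axis k 1)"
        unfolding R(2)[symmetric] matrix_vector_mult_diff_rdistrib tv M
        by (simp add: inner inner_diff_right inner_add_right algebra_simps)
      finally show ?thesis by (auto simp: inner_axis_axis l_def)
    qed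
    have "det R * det R = 1" using det_orthogonal_matrix[OF R(1)] by auto
    then have "det (mat t - M) = det ?N" by (simp add: det_mul)
    also have "\<dots> = (\<Prod>i\<in>UNIV. ?N $ i $ i)" by (rule det_diagonal) (simp add: N)
    finally show ?thesis by (simp add: N)
  qed
  then have "has_eigenvalues M l" by (simp add: has_eigenvalues_def)
  then show thesis using that unfolding l_def by blast
qed

text \<open>Both vectors list the roots of the same polynomial.\<close>

lemma eigenvalues_entry:
  fixes M :: "real^'n^'n"
  assumes "has_eigenvalues M l"
  obtains j where "eigenvalues M $ i = l $ j"
proof -
  have "has_eigenvalues M (eigenvalues M)" by (rule has_eigenvalues_eigenvalues[OF assms])
  then have "det (mat (eigenvalues M $ i) - M) = 0" by (auto simp: has_eigenvalues_def)
  then have "\<exists>j. eigenvalues M $ i - l $ j = 0" using assms by (auto simp: has_eigenvalues_def)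
  then show thesis using that by auto
qed

lemma S_sym_ge:
  fixes l :: "real^'n"
  assumes "k \<le> CARD('n)" "0 < \<mu>" "\<And>i. \<mu> \<le> l $ i"
  shows "\<mu> ^ k \<le> S_sym k l"
proof -
  obtain A0 :: "'n set" where A0: "card A0 = k" using obtain_subset_with_card_n[OF assms(1)] by blast
  have ge: "\<mu> ^ card A \<le> (\<Prod>i\<in>A. l $ i)" for A
    unfolding prod_constant[symmetric] using assms by (intro prod_mono) auto
  have "\<mu> ^ k \<le> (\<Prod>i\<in>A0. l $ i)" using ge[of A0] A0 by simp
  also have "\<dots> \<le> S_sym k l" unfolding S_sym_def
    using A0 assms order_trans[OF less_imp_le[OF assms(2)] assms(3)]
    by (intro member_le_sum[of A0 _ "\<lambda>A. \<Prod>i\<in>A. l $ i"]) (auto intro!: prod_nonneg)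
  finally show ?thesis .
qed

lemma Pi_sym_ge:
  fixes l :: "real^'n"
  assumes "1 \<le> k" "0 < \<mu>" "\<And>i. \<mu> \<le> l $ i"
  shows "l \<in> P_cone k" "\<mu> ^ (CARD('n) choose k) \<le> Pi_sym k l"
proof -
  have ge: "\<mu> \<le> (\<Sum>i\<in>A. l $ i)" if "card A = k" for A
  proof -
    have "1 * \<mu> \<le> real (card A) * \<mu>" using that assms by (intro mult_right_mono) auto
    also have "\<dots> = (\<Sum>i\<in>A. \<mu>)" by simp
    also have "\<dots> \<le> (\<Sum>i\<in>A. l $ i)" by (intro sum_mono assms)
    finally show ?thesis by simp
  qed
  then show "l \<in> P_cone k" using assms(2) by (force simp: P_cone_def)
  have "\<mu> ^ (CARD('n) choose k) = (\<Prod>A | card (A::'n set) = k. \<mu>)"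
    using n_subsets[of "UNIV::'n set" k] by simp
  also have "\<dots> \<le> Pi_sym k l" unfolding Pi_sym_def using assms(2) ge by (intro prod_mono) auto
  finally show "\<mu> ^ (CARD('n) choose k) \<le> Pi_sym k l" .
qed

text \<open>The property that the two operators with their cones share and that makes the radial power a
  subsolution.\<close>

definition dominates_least_eigenvalue :: "(real^'n) set \<Rightarrow> (real^'n^'n \<Rightarrow> real) \<Rightarrow> bool" where
  "dominates_least_eigenvalue K Q \<longleftrightarrow> (\<forall>M l \<mu>. has_eigenvalues M l \<longrightarrow> 0 < \<mu> \<longrightarrow> (\<forall>i. \<mu> \<le> l $ i) \<longrightarrow>
     eigenvalues M \<in> K \<and> \<mu> \<le> Q M)"

lemma dominates_least_eigenvalue_S:
  assumes "1 \<le> k" "k \<le> CARD('n)"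
  shows "dominates_least_eigenvalue (Gamma_cone k) (\<lambda>M::real^'n^'n. root k (S_mat k M))"
  unfolding dominates_least_eigenvalue_def
proof (intro allI impI)
  fix M :: "real^'n^'n" and l \<mu> assume l: "has_eigenvalues M l" and \<mu>: "0 < \<mu>" "\<forall>i. \<mu> \<le> l $ i"
  have ge: "\<mu> \<le> eigenvalues M $ i" for i using eigenvalues_entry[OF l, of i] \<mu>(2) by metis
  have "0 < S_sym i (eigenvalues M)" if "i \<le> k" for i
    using S_sym_ge[of i \<mu> "eigenvalues M"] that assms(2) \<mu>(1) ge by (meson order_trans order_less_le_trans zero_less_power)
  then have "eigenvalues M \<in> Gamma_cone k" by (auto simp: Gamma_cone_def)
  moreover have "\<mu> = root k (\<mu> ^ k)" using assms \<mu> by (simp add: real_root_power_cancel)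
  moreover have "\<dots> \<le> root k (S_mat k M)"
    using S_sym_ge[OF assms(2) \<mu>(1) ge] assms by (simp add: S_mat_def)
  ultimately show "eigenvalues M \<in> Gamma_cone k \<and> \<mu> \<le> root k (S_mat k M)" by simp
qed

lemma dominates_least_eigenvalue_Pi:
  assumes "1 \<le> k" "k \<le> CARD('n)"
  shows "dominates_least_eigenvalue (P_cone k) (\<lambda>M::real^'n^'n. root (CARD('n) choose k) (Pi_mat k M))"
  unfolding dominates_least_eigenvalue_def
proof (intro allI impI)
  fix M :: "real^'n^'n" and l \<mu> assume l: "has_eigenvalues M l" and \<mu>: "0 < \<mu>" "\<forall>i. \<mu> \<le> l $ i"
  let ?N = "CARD('n) choose k"
  have N: "0 < ?N" using assms(2) by (simp add: zero_less_binomial_iff)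
  have ge: "\<mu> \<le> eigenvalues M $ i" for i using eigenvalues_entry[OF l, of i] \<mu>(2) by metis
  have "\<mu> = root ?N (\<mu> ^ ?N)" using N \<mu> by (simp add: real_root_power_cancel)
  also have "\<dots> \<le> root ?N (Pi_mat k M)"
    using Pi_sym_ge(2)[OF assms(1) \<mu>(1) ge] N by (simp add: Pi_mat_def)
  finally show "eigenvalues M \<in> P_cone k \<and> \<mu> \<le> root ?N (Pi_mat k M)"
    using Pi_sym_ge(1)[OF assms(1) \<mu>(1) ge] by simp
qed

lemma power_field_jacobian_eigenvalues:
  fixes x :: "real^'n"
  assumes "x \<noteq> 0"
  obtains k where "has_eigenvalues (B *\<^sub>R power_field_jacobian s x)
    (\<chi> i. if i = k then B * norm x powr s * (s + 1) else B * norm x powr s)"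
proof -
  define e where "e = x /\<^sub>R norm x"
  have e: "norm e = 1" using assms by (simp add: e_def)
  have "(B *\<^sub>R power_field_jacobian s x) *v h
      = (B * norm x powr s) *\<^sub>R h + (B * norm x powr s * s * (e \<bullet> h)) *\<^sub>R e" for h
    using assms by (simp add: scaleR_matrix_vector_assoc[symmetric] power_field_jacobian_mult e_def powr_diff
        scaleR_add_right field_simps power2_eq_square)
  from has_eigenvalues_rank_one[OF e this] obtain k where
    "has_eigenvalues (B *\<^sub>R power_field_jacobian s x)
      (\<chi> i. if i = k then B * norm x powr s + B * norm x powr s * s else B * norm x powr s)" .
  moreover have "B * norm x powr s + B * norm x powr s * s = B * norm x powr s * (s + 1)"
    by (simp add: algebra_simps)
  ultimately show thesis by (intro that[of k]) (simp only:)
qed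

section \<open>The radial power subsolution\<close>

lemma p_field_of_power:
  fixes u :: "real^'n \<Rightarrow> real"
  assumes "0 < a" "\<And>x. grad u x = a *\<^sub>R power_field s x"
  shows "p_field p u = (\<lambda>x. a powr (p - 1) *\<^sub>R power_field ((s + 1) * (p - 1) - 1) x)"
proof
  fix x :: "real^'n"
  show "p_field p u x = a powr (p - 1) *\<^sub>R power_field ((s + 1) * (p - 1) - 1) x"
  proof (cases "x = 0")
    case False
    have "p_field p u x = ((a * norm x powr (s + 1)) powr (p - 2) * (a * norm x powr s)) *\<^sub>R x"
      using assms(1) by (simp add: p_field_def assms(2) norm_power_field) (simp add: power_field_def)
    also have "(a * norm x powr (s + 1)) powr (p - 2) * (a * norm x powr s)
        = (a powr (p - 2) * a powr 1) * (norm x powr ((s + 1) * (p - 2)) * norm x powr s)"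
      using assms(1) by (simp add: powr_mult powr_powr)
    also have "\<dots> = a powr (p - 1) * norm x powr ((s + 1) * (p - 1) - 1)"
      unfolding powr_add[symmetric] by (simp add: algebra_simps)
    finally show ?thesis by (simp add: power_field_def)
  qed (simp add: p_field_def assms(2) power_field_def)
qed

text \<open>The exponent g solves g (p - 1) - 1 = \<alpha> + g \<beta>, so the least eigenvalue of the Jacobian and the right
  side are multiples of the same power of |x|. With a = A (g + 1) and m = g (p - 1) the factors are
  a^(p-1) min (1, m) and a^\<beta>, and they are made equal.\<close>

lemma radial_power_subsolution:
  fixes K :: "(real^'n) set" and Q :: "real^'n^'n \<Rightarrow> real"
  assumes KQ: "dominates_least_eigenvalue K Q"
    and p: "1 < p" and \<beta>: "\<beta> < p - 1" and \<alpha>: "-1 < \<alpha>"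
  defines "g \<equiv> (\<alpha> + 1) / (p - 1 - \<beta>)"
  obtains A where "0 < A"
    "admissible K p (\<lambda>x. A * norm x powr (g + 1))"
    "satisfies_ge Q p \<alpha> \<beta> (\<lambda>t. 1) (\<lambda>x. A * norm x powr (g + 1))"
    "\<And>x::real^'n. ((\<lambda>x. A * norm x powr (g + 1)) has_derivative (\<lambda>h. ((A * (g + 1)) *\<^sub>R power_field (g - 1) x) \<bullet> h)) (at x)"
    "p_field p (\<lambda>x::real^'n. A * norm x powr (g + 1)) = (\<lambda>x. (A * (g + 1)) powr (p - 1) *\<^sub>R power_field (g * (p - 1) - 1) x)"
proof -
  define \<sigma> where "\<sigma> = p - 1 - \<beta>"
  have \<sigma>: "0 < \<sigma>" using \<beta> by (simp add: \<sigma>_def)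
  have g: "0 < g" using \<alpha> \<sigma> by (simp add: g_def \<sigma>_def)
  have gs: "g * \<sigma> = \<alpha> + 1" using \<sigma> by (simp add: g_def \<sigma>_def)
  define m where "m = g * (p - 1)"
  have m: "0 < m" using g p by (simp add: m_def)
  define \<nu> where "\<nu> = min 1 m"
  have \<nu>: "0 < \<nu>" "\<nu> \<le> 1" "\<nu> \<le> m" using m by (auto simp: \<nu>_def)
  \<comment> \<open>The solution of a^(p-1) \<nu> = a^\<beta>.\<close>
  define a where "a = (1 / \<nu>) powr (1 / \<sigma>)"
  have a: "0 < a" using \<nu> by (simp add: a_def)
  have a\<sigma>: "a powr \<sigma> * \<nu> = 1" using \<nu> \<sigma> by (simp add: a_def powr_powr)
  define A where "A = a / (g + 1)"
  have Ag: "A * (g + 1) = a" using g by (simp add: A_def)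
  have A: "0 < A" using a g by (simp add: A_def)
  define u :: "real^'n \<Rightarrow> real" where "u = (\<lambda>x. A * norm x powr (g + 1))"
  have du: "(u has_derivative (\<lambda>h. (a *\<^sub>R power_field (g - 1) x) \<bullet> h)) (at x)" for x
  proof -
    have "(u has_derivative (\<lambda>h. A * (((g + 1) *\<^sub>R power_field (g + 1 - 2) x) \<bullet> h))) (at x)"
      unfolding u_def by (intro has_derivative_mult_right has_derivative_norm_powr_everywhere) (use g in simp)
    then show ?thesis by (simp add: Ag[symmetric] mult.assoc)
  qed
  have gu: "grad u x = a *\<^sub>R power_field (g - 1) x" for x by (rule grad_eqI[OF du])
  have pf: "p_field p u = (\<lambda>x. a powr (p - 1) *\<^sub>R power_field (m - 1) x)"
    using p_field_of_power[OF a gu] by (simp add: m_def)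
  have D: "D_field p u x = a powr (p - 1) *\<^sub>R power_field_jacobian (m - 1) x" if "x \<noteq> 0" for x
    unfolding D_field_def pf using that
    by (simp add: C1_field_scaleR(2)[OF C1_power_field_away(1)] C1_power_field_away(2))
  have bound: "(\<exists>l. has_eigenvalues (D_field p u x) l) \<and> eigenvalues (D_field p u x) \<in> K \<and>
      a powr (p - 1) * norm x powr (m - 1) * \<nu> \<le> Q (D_field p u x)" if x: "x \<noteq> 0" for x
  proof -
    let ?c = "a powr (p - 1) * norm x powr (m - 1)"
    have c: "0 < ?c" using a x by simp
    obtain k where k: "has_eigenvalues (D_field p u x) (\<chi> i. if i = k then ?c * (m - 1 + 1) else ?c)"
      unfolding D[OF x] by (rule power_field_jacobian_eigenvalues[OF x])
    have "\<forall>i. ?c * \<nu> \<le> (\<chi> i. if i = k then ?c * (m - 1 + 1) else ?c) $ i"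
      using mult_left_mono[OF \<nu>(2) less_imp_le[OF c]] mult_left_mono[OF \<nu>(3) less_imp_le[OF c]] by simp
    with k KQ c \<nu>(1) show ?thesis unfolding dominates_least_eigenvalue_def by (meson mult_pos_pos)
  qed
  have "admissible K p u"
    unfolding admissible_def using bound by (simp add: pf C1_field_scaleR(1) C1_power_field_away(1))
  moreover have "satisfies_ge Q p \<alpha> \<beta> (\<lambda>t. 1) u"
    unfolding satisfies_ge_def
  proof (intro allI impI conjI)
    fix x :: "real^'n" assume x: "x \<noteq> 0"
    show "grad u x \<noteq> 0" using a x by (simp add: gu power_field_def)
    have n: "norm (grad u x) = a * norm x powr g" using a by (simp add: gu norm_power_field)
    have "rpow (norm (grad u x)) \<beta> = a powr \<beta> * norm x powr (g * \<beta>)"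
      unfolding n rpow_def using a x by (simp add: powr_mult powr_powr)
    then have "norm x powr \<alpha> * rpow (norm (grad u x)) \<beta> = a powr \<beta> * norm x powr (\<alpha> + g * \<beta>)"
      by (simp add: powr_add)
    also have "\<alpha> + g * \<beta> = m - 1" using gs by (simp add: m_def \<sigma>_def algebra_simps)
    also have "a powr \<beta> = a powr (p - 1) * \<nu>"
    proof -
      have "a powr (p - 1) = a powr \<beta> * a powr \<sigma>" by (simp add: \<sigma>_def powr_add[symmetric])
      then show ?thesis using a\<sigma> by simp
    qed
    finally show "norm x powr \<alpha> * rpow (norm (grad u x)) \<beta> * 1 \<le> Q (D_field p u x)"
      using bound[OF x] by (simp add: mult_ac)
  qed
  ultimately show thesis
    by (rule that[OF A, folded u_def, unfolded Ag, folded m_def, OF _ _ du pf])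
qed

section \<open>Integrability of powers of the distance to the origin\<close>

lemma integrable_cball_continuous:
  fixes f :: "'a::euclidean_space \<Rightarrow> real"
  assumes "continuous_on UNIV f" "\<And>x. R < norm x \<Longrightarrow> f x = 0"
  shows "integrable lborel f"
proof -
  have "(\<lambda>x. indicator (cball 0 R) x *\<^sub>R f x) = f"
    using assms(2) by (auto simp: fun_eq_iff indicator_def not_le)
  moreover have "integrable lborel (\<lambda>x. indicator (cball 0 R) x *\<^sub>R f x)"
    by (intro borel_integrable_compact compact_cball) (rule continuous_on_subset[OF assms(1)], simp)
  ultimately show ?thesis by simp
qed

lemma borel_measurable_off_origin:
  fixes f :: "'a::euclidean_space \<Rightarrow> real"
  assumes "continuous_on (- {0}) f"
  shows "f \<in> borel_measurable borel"
proof -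
  have "(\<lambda>x. indicator (- {0}) x *\<^sub>R f x) \<in> borel_measurable borel"
    by (rule borel_measurable_continuous_on_indicator) (use assms in auto)
  then have "(\<lambda>x. if x = 0 then f 0 else indicator (- {0}) x *\<^sub>R f x) \<in> borel_measurable borel"
    by measurable
  moreover have "(\<lambda>x. if x = 0 then f 0 else indicator (- {0}) x *\<^sub>R f x) = f" by (auto simp: fun_eq_iff)
  ultimately show ?thesis by simp
qed

text \<open>Dyadic shells: where 2^(-j-1) \<le> |x| < 2^(-j), the integrand is at most 2^(-(j+1) a), and the volume
  of the ball of radius 2^(-j) is at most a constant times 2^(-j) in every dimension. The resulting
  geometric series has ratio 2^(-(a+1)) < 1.\<close>

lemma nn_integral_norm_powr_unit_ball:
  assumes a: "-1 < a" "a < 0"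
  shows "(\<integral>\<^sup>+(x::'a::euclidean_space). ennreal (norm x powr a) * indicator (ball 0 1) x \<partial>lborel) < \<infinity>"
proof -
  have [measurable]: "ball (0::'a) r \<in> sets borel" for r by simp
  define V where "V = unit_ball_vol (real DIM('a))"
  have V: "0 \<le> V" by (simp add: V_def)
  define c :: "nat \<Rightarrow> real" where "c j = ((1/2) ^ Suc j) powr a" for j
  have pp: "((1/2::real) ^ j) powr a = ((1/2) powr a) ^ j" for j
    by (simp add: powr_realpow[symmetric] powr_powr mult.commute)
  have "(\<integral>\<^sup>+(x::'a). ennreal (norm x powr a) * indicator (ball 0 1) x \<partial>lborel)
      \<le> (\<integral>\<^sup>+(x::'a). (\<Sum>j. ennreal (c j) * indicator (ball 0 ((1/2) ^ j)) x) \<partial>lborel)"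
  proof (rule nn_integral_mono)
    fix x :: 'a
    show "ennreal (norm x powr a) * indicator (ball 0 1) x \<le> (\<Sum>j. ennreal (c j) * indicator (ball 0 ((1/2) ^ j)) x)"
    proof (cases "x \<noteq> 0 \<and> norm x < 1")
      case True
      obtain m where "(1/2) ^ m < norm x" using real_arch_pow_inv[of "norm x" "1/2"] True by auto
      then have ex: "\<exists>j. (1/2) ^ Suc j \<le> norm x"
        using True by (intro exI[of _ m]) (auto intro: order_trans[OF _ less_imp_le])
      define j where "j = (LEAST j. (1/2) ^ Suc j \<le> norm x)"
      have j: "(1/2) ^ Suc j \<le> norm x" unfolding j_def by (rule LeastI_ex[OF ex])
      have "norm x < (1/2) ^ j"
      proof (cases j)
        case (Suc i)
        then have "\<not> (1/2) ^ Suc i \<le> norm x" unfolding j_def by (metis not_less_Least lessI)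
        then show ?thesis using Suc by simp
      qed (use True in simp)
      then have "ennreal (norm x powr a) * indicator (ball 0 1) x \<le> ennreal (c j) * indicator (ball 0 ((1/2) ^ j)) x"
        using True j a by (auto simp: c_def intro!: ennreal_leI powr_mono2')
      also have "\<dots> \<le> (\<Sum>j. ennreal (c j) * indicator (ball 0 ((1/2) ^ j)) x)"
      proof -
        have "f j \<le> (\<Sum>k. f k)" for f :: "nat \<Rightarrow> ennreal" using sum_le_suminf[of f "{j}"] by simp
        then show ?thesis .
      qed
      finally show ?thesis .
    qed auto
  qed
  also have "\<dots> = (\<Sum>j. \<integral>\<^sup>+(x::'a). ennreal (c j) * indicator (ball 0 ((1/2) ^ j)) x \<partial>lborel)"
    by (rule nn_integral_suminf) measurable
  also have "\<dots> \<le> (\<Sum>j. ennreal ((1/2) powr a * V * ((1/2) powr (a + 1)) ^ j))"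
  proof (rule suminf_le)
    fix j :: nat
    have "(\<integral>\<^sup>+(x::'a). ennreal (c j) * indicator (ball 0 ((1/2) ^ j)) x \<partial>lborel)
        = ennreal (c j) * ennreal (V * ((1/2) ^ j) ^ DIM('a))"
      by (simp add: nn_integral_cmult_indicator emeasure_ball V_def)
    also have "\<dots> = ennreal (c j * (V * ((1/2) ^ j) ^ DIM('a)))"
      using V by (simp add: ennreal_mult c_def)
    also have "\<dots> \<le> ennreal (c j * (V * (1/2) ^ j))"
    proof (intro ennreal_leI mult_left_mono V)
      have "((1/2::real) ^ j) ^ DIM('a) \<le> ((1/2) ^ j) ^ 1"
        by (rule power_decreasing) (auto simp: power_le_one Suc_le_eq)
      then show "((1/2::real) ^ j) ^ DIM('a) \<le> (1/2) ^ j" by simp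
    qed (simp add: c_def)
    also have "c j * (V * (1/2) ^ j) = (1/2) powr a * V * ((1/2) powr (a + 1)) ^ j"
      unfolding c_def pp by (simp add: powr_add power_mult_distrib field_simps)
    finally show "(\<integral>\<^sup>+(x::'a). ennreal (c j) * indicator (ball 0 ((1/2) ^ j)) x \<partial>lborel)
        \<le> ennreal ((1/2) powr a * V * ((1/2) powr (a + 1)) ^ j)" .
  qed auto
  also have "\<dots> < \<infinity>"
  proof -
    have "(1/2::real) powr (a + 1) < 1" using powr_less_mono2[of "a + 1" "1/2" 1] a by simp
    then have "summable (\<lambda>j. (1/2) powr a * V * ((1/2) powr (a + 1)) ^ j)"
      by (intro summable_mult summable_geometric) simp
    then have "(\<Sum>j. ennreal ((1/2) powr a * V * ((1/2) powr (a + 1)) ^ j)) \<noteq> top"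
      using V by (intro ennreal_suminf_neq_top) auto
    then show ?thesis by (simp add: less_top)
  qed
  finally show ?thesis .
qed

text \<open>Outside the unit ball a negative power is at most 1.\<close>

lemma integrable_norm_powr_cball:
  assumes a: "-1 < a"
  shows "integrable lborel (\<lambda>x::'a::euclidean_space. indicator (cball 0 R) x * norm x powr a)"
proof -
  have [measurable]: "ball (0::'a) r \<in> sets borel" "cball (0::'a) r \<in> sets borel" for r by simp_all
  have ind: "integrable lborel (\<lambda>x::'a. indicator (cball 0 R) x :: real)"
    by (rule integrable_real_indicator) (use emeasure_lborel_cball_finite in auto)
  show ?thesis
  proof (cases "a < 0")
    case False
    have "integrable lborel (\<lambda>x::'a. (max R 0 powr a) * indicator (cball 0 R) x :: real)"
      using ind by (rule integrable_mult_right)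
    then show ?thesis
      by (rule Bochner_Integration.integrable_bound)
        (use False in \<open>auto simp: indicator_def intro!: powr_mono2 split: if_splits\<close>)
  next
    case True
    have "integrable lborel (\<lambda>x::'a. norm x powr a * indicator (ball 0 1) x)"
    proof (rule integrableI_nonneg)
      have "(\<integral>\<^sup>+(x::'a). ennreal (norm x powr a * indicator (ball 0 1) x) \<partial>lborel)
          = (\<integral>\<^sup>+(x::'a). ennreal (norm x powr a) * indicator (ball 0 1) x \<partial>lborel)"
        by (intro nn_integral_cong) (auto simp: indicator_def)
      then show "(\<integral>\<^sup>+(x::'a). ennreal (norm x powr a * indicator (ball 0 1) x) \<partial>lborel) < \<infinity>"
        using nn_integral_norm_powr_unit_ball[OF a True, where 'a = 'a] by simp
      show "(\<lambda>x::'a. norm x powr a * indicator (ball 0 1) x) \<in> borel_measurable lborel" by measurable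
    qed auto
    from Bochner_Integration.integrable_add[OF this ind] show ?thesis
    proof (rule Bochner_Integration.integrable_bound)
      show "AE x::'a in lborel. norm (indicator (cball 0 R) x * norm x powr a)
          \<le> norm (norm x powr a * indicator (ball 0 1) x + indicator (cball 0 R) x)"
      proof (rule AE_I2)
        fix x :: 'a
        show "norm (indicator (cball 0 R) x * norm x powr a)
          \<le> norm (norm x powr a * indicator (ball 0 1) x + indicator (cball 0 R) x)"
        proof (cases "norm x < 1")
          case False
          then have "norm x powr a \<le> norm x powr 0" using True by (intro powr_mono) auto
          moreover have "x \<noteq> 0" using False by auto
          ultimately show ?thesis using False by (auto simp: indicator_def)
        qed (auto simp: indicator_def)
      qed
    qed measurable
  qed
qed

lemma Lloc_of_power_bound:
  fixes g :: "real^'n \<Rightarrow> real"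
  assumes meas: "g \<in> borel_measurable borel" and \<delta>: "0 < \<delta>" and s: "-1 < s * \<delta>"
    and bound: "\<And>x. \<bar>g x\<bar> \<le> C * norm x powr s"
  shows "Lloc \<delta> g"
  unfolding Lloc_def
proof (intro conjI allI impI)
  show "g \<in> borel_measurable lebesgue" using meas by (intro measurable_completion) simp
  fix K :: "(real^'n) set" assume K: "compact K"
  have [measurable]: "K \<in> sets borel" using K by (rule borel_compact)
  note [measurable] = meas
  from K obtain R where R: "\<And>x. x \<in> K \<Longrightarrow> norm x \<le> R" by (meson bounded_iff compact_imp_bounded)
  have "integrable lborel (\<lambda>x::real^'n. \<bar>C\<bar> powr \<delta> * (indicator (cball 0 R) x * norm x powr (s * \<delta>)))"
    by (intro integrable_mult_right integrable_norm_powr_cball s)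
  then have "integrable lborel (\<lambda>x. indicator K x *\<^sub>R \<bar>g x\<bar> powr \<delta>)"
  proof (rule Bochner_Integration.integrable_bound)
    show "AE x in lborel. norm (indicator K x *\<^sub>R \<bar>g x\<bar> powr \<delta>)
        \<le> norm (\<bar>C\<bar> powr \<delta> * (indicator (cball 0 R) x * norm x powr (s * \<delta>)))"
    proof (rule AE_I2)
      fix x :: "real^'n"
      have "\<bar>g x\<bar> \<le> \<bar>C\<bar> * norm x powr s"
        using bound[of x] by (rule order_trans) (simp add: mult_right_mono)
      then have "\<bar>g x\<bar> powr \<delta> \<le> (\<bar>C\<bar> * norm x powr s) powr \<delta>"
        using \<delta> by (intro powr_mono2) auto
      also have "\<dots> = \<bar>C\<bar> powr \<delta> * norm x powr (s * \<delta>)" by (simp add: powr_mult powr_powr)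
      finally show "norm (indicator K x *\<^sub>R \<bar>g x\<bar> powr \<delta>)
        \<le> norm (\<bar>C\<bar> powr \<delta> * (indicator (cball 0 R) x * norm x powr (s * \<delta>)))"
        using R[of x] by (auto simp: indicator_def)
    qed
    show "(\<lambda>x. indicator K x *\<^sub>R \<bar>g x\<bar> powr \<delta>) \<in> borel_measurable lborel"
      by measurable
  qed
  moreover have "(\<lambda>x. indicator K x *\<^sub>R \<bar>g x\<bar> powr \<delta>) \<in> borel_measurable lborel"
    by measurable
  ultimately show "set_integrable lebesgue K (\<lambda>x. \<bar>g x\<bar> powr \<delta>)"
    unfolding set_integrable_def by (simp add: integrable_completion)
qed

section \<open>Integration by parts\<close>

lemma integral_lborel_translate:
  fixes f :: "'a::euclidean_space \<Rightarrow> real"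
  assumes "f \<in> borel_measurable borel"
  shows "(LINT x|lborel. f (x + c)) = (LINT x|lborel. f x)"
proof -
  have "(LINT x|lborel. f x) = (LINT x|distr lborel borel ((+) c). f x)"
    by (simp only: lborel_distr_plus)
  also have "\<dots> = (LINT x|lborel. f (c + x))"
    using assms by (intro integral_distr) auto
  finally show ?thesis by (simp add: add.commute)
qed

lemma grad_zero_outside:
  fixes g :: "real^'n \<Rightarrow> real"
  assumes "\<And>y. R < norm y \<Longrightarrow> g y = 0" "R < norm x"
  shows "grad g x = 0"
proof (rule grad_eqI)
  have "(g has_derivative (\<lambda>h. 0)) (at x)"
    by (rule has_derivative_transform_within_open[of "\<lambda>_. 0" _ _ _ "- cball 0 R"])
      (use assms in \<open>auto simp: open_Compl not_le\<close>)
  then show "(g has_derivative (\<lambda>h. 0 \<bullet> h)) (at x)" by simp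
qed

text \<open>The difference quotients of \<open>g\<close> have integral 0 by translation invariance. By the mean value theorem
  they are bounded by the maximum of the partial derivative, and they vanish outside a fixed ball, so
  the integral passes to the limit.\<close>

lemma integral_partial_zero:
  fixes g :: "real^'n \<Rightarrow> real"
  assumes diff: "\<And>x. g differentiable (at x)" and cont: "continuous_on UNIV (grad g)"
    and supp: "\<And>x. R < norm x \<Longrightarrow> g x = 0"
  shows "(LINT x|lborel. grad g x $ i) = 0"
proof -
  let ?e = "axis i 1 :: real^'n"
  have g_cont: "continuous_on UNIV g"
    by (intro continuous_at_imp_continuous_on ballI differentiable_imp_continuous_within diff)
  have g_int: "integrable lborel g" by (rule integrable_cball_continuous[OF g_cont supp])
  have [measurable]: "g \<in> borel_measurable borel" by (rule borel_measurable_continuous_onI[OF g_cont])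
  have gi_cont: "continuous_on UNIV (\<lambda>x. grad g x $ i)" by (intro continuous_intros cont)
  have [measurable]: "(\<lambda>x. grad g x $ i) \<in> borel_measurable borel"
    by (rule borel_measurable_continuous_onI[OF gi_cont])
  have "bounded ((\<lambda>x. grad g x $ i) ` cball 0 R)"
    by (intro compact_imp_bounded compact_continuous_image compact_cball continuous_on_subset[OF gi_cont]) simp
  then obtain C0 where "\<forall>x\<in>cball 0 R. \<bar>grad g x $ i\<bar> \<le> C0"
    by (auto simp: bounded_iff)
  then have C0: "\<And>x. norm x \<le> R \<Longrightarrow> \<bar>grad g x $ i\<bar> \<le> C0" by simp
  define C where "C = max C0 0"
  have C: "\<bar>grad g x $ i\<bar> \<le> C" for x
    using C0[of x] grad_zero_outside[OF supp, where x = x] by (cases "norm x \<le> R") (auto simp: C_def)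
  define h :: "nat \<Rightarrow> real" where "h k = inverse (real (Suc k))" for k
  have h: "0 < h k" "h k \<le> 1" for k by (auto simp: h_def inverse_le_1_iff)
  have h0: "h \<longlonglongrightarrow> 0" unfolding h_def by (rule LIMSEQ_inverse_real_of_nat)
  define d where "d k x = (g (x + h k *\<^sub>R ?e) - g x) / h k" for k x
  have int_d: "(LINT x|lborel. d k x) = 0" for k
  proof -
    have "integrable lborel (\<lambda>x. g (x + h k *\<^sub>R ?e))"
    proof (rule integrable_cball_continuous[of _ "R + 1"])
      show "continuous_on UNIV (\<lambda>x. g (x + h k *\<^sub>R ?e))"
        by (rule continuous_on_compose2[OF g_cont]) (auto intro!: continuous_intros)
      fix x :: "real^'n" assume "R + 1 < norm x"
      moreover have "norm x \<le> norm (x + h k *\<^sub>R ?e) + norm (h k *\<^sub>R ?e)" by (metis add_diff_cancel_right' norm_triangle_ineq4)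
      ultimately show "g (x + h k *\<^sub>R ?e) = 0" using h[of k] by (intro supp) simp
    qed
    then have "(LINT x|lborel. g (x + h k *\<^sub>R ?e) - g x) = (LINT x|lborel. g (x + h k *\<^sub>R ?e)) - (LINT x|lborel. g x)"
      using g_int by (rule Bochner_Integration.integral_diff)
    then show ?thesis by (simp add: d_def integral_lborel_translate)
  qed
  have "(\<lambda>k. LINT x|lborel. d k x) \<longlonglongrightarrow> (LINT x|lborel. grad g x $ i)"
  proof (rule integral_dominated_convergence[where w = "\<lambda>x. C * indicator (cball 0 (R + 1)) x"])
    show "integrable lborel (\<lambda>x::real^'n. C * indicator (cball 0 (R + 1)) x)"
      using emeasure_lborel_cball_finite by (intro integrable_mult_right integrable_real_indicator) auto
    show "AE x in lborel. (\<lambda>k. d k x) \<longlonglongrightarrow> grad g x $ i"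
    proof (rule AE_I2)
      fix x :: "real^'n"
      have "((\<lambda>t. g (x + t *\<^sub>R ?e)) has_real_derivative grad g x $ i) (at 0)"
        using grad_along_line[OF diff, where x = x and t = 0 and y = ?e] by (simp add: inner_axis)
      then have lim: "((\<lambda>t. (g (x + t *\<^sub>R ?e) - g x) / t) \<longlongrightarrow> grad g x $ i) (at 0)"
        by (simp add: DERIV_def)
      show "(\<lambda>k. d k x) \<longlonglongrightarrow> grad g x $ i"
        unfolding d_def
        by (rule filterlim_compose[OF lim]) (use h0 in \<open>auto simp: filterlim_at less_imp_neq[OF h(1), symmetric]\<close>)
    qed
    fix k
    show "AE x in lborel. norm (d k x) \<le> C * indicator (cball 0 (R + 1)) x"
    proof (rule AE_I2)
      fix x :: "real^'n"
      show "norm (d k x) \<le> C * indicator (cball 0 (R + 1)) x"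
      proof (cases "norm x \<le> R + 1")
        case False
        moreover have "norm x \<le> norm (x + h k *\<^sub>R ?e) + norm (h k *\<^sub>R ?e)" by (metis add_diff_cancel_right' norm_triangle_ineq4)
        ultimately have "g (x + h k *\<^sub>R ?e) = 0" "g x = 0" using h[of k] by (auto intro!: supp)
        then show ?thesis using False by (simp add: d_def)
      next
        case True
        obtain z where "g (x + h k *\<^sub>R ?e) - g (x + 0 *\<^sub>R ?e) = (h k - 0) * (grad g (x + z *\<^sub>R ?e) \<bullet> ?e)"
          using MVT2[OF h(1)[of k], of "\<lambda>t. g (x + t *\<^sub>R ?e)" "\<lambda>t. grad g (x + t *\<^sub>R ?e) \<bullet> ?e"] grad_along_line[OF diff] by blast
        then have "d k x = grad g (x + z *\<^sub>R ?e) $ i" using h[of k] by (simp add: d_def inner_axis)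
        then show ?thesis using C True by simp
      qed
    qed
  qed (auto simp: d_def)
  then show ?thesis using int_d by (simp add: LIMSEQ_const_iff)
qed

lemma test_function_support:
  assumes "test_function \<phi>"
  obtains R where "\<And>x. R < norm x \<Longrightarrow> \<phi> x = 0"
proof -
  have "bounded {x. \<phi> x \<noteq> 0}"
    using assms by (auto simp: test_function_def dest!: compact_imp_bounded intro: bounded_subset closure_subset)
  then obtain R where "\<And>x. \<phi> x \<noteq> 0 \<Longrightarrow> norm x \<le> R" by (auto simp: bounded_iff)
  then show thesis using that by (metis not_less)
qed

lemma test_function_grad:
  assumes "test_function \<phi>"
  shows "\<And>x. \<phi> differentiable (at x)" "continuous_on UNIV (grad \<phi>)"
    and "\<And>i. test_function (partial i \<phi>)"
proof -
  have d: "iter_partial is \<phi> differentiable (at x)" for "is" x using assms by (simp add: test_function_def)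
  show d0: "\<phi> differentiable (at x)" for x using d[of "[]"] by simp
  have dp: "partial i \<phi> differentiable (at x)" for i x using d[of "[i]"] by simp
  have "continuous_on UNIV (\<lambda>x. grad \<phi> x $ i)" for i
    unfolding grad_def using dp by (auto intro!: continuous_at_imp_continuous_on differentiable_imp_continuous_within)
  then show "continuous_on UNIV (grad \<phi>)" by (simp add: continuous_on_vec_lambda[where f = "\<lambda>i x. grad \<phi> x $ i", simplified])
  fix i
  have iter: "iter_partial is (partial i \<phi>) = iter_partial (is @ [i]) \<phi>" for "is" by (induction "is") auto
  obtain R where R: "\<And>x. R < norm x \<Longrightarrow> \<phi> x = 0" using test_function_support[OF assms] by blast
  have "{x. partial i \<phi> x \<noteq> 0} \<subseteq> cball 0 R"
  proof
    fix x assume x: "x \<in> {x. partial i \<phi> x \<noteq> 0}"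
    have "grad \<phi> x = 0" if "R < norm x" by (rule grad_zero_outside[OF R that])
    then show "x \<in> cball 0 R" using x by (auto simp: grad_def vec_eq_iff not_less[symmetric])
  qed
  then have "bounded {x. partial i \<phi> x \<noteq> 0}" by (rule bounded_subset[OF bounded_cball])
  then show "test_function (partial i \<phi>)" using d by (simp add: test_function_def iter compact_closure)
qed

text \<open>The product \<open>G \<phi>\<close> is C^1 with compact support, so the integral of its partial derivative vanishes.\<close>

lemma integration_by_parts:
  fixes G :: "real^'n \<Rightarrow> real"
  assumes diff: "\<And>x. G differentiable (at x)" and cont: "continuous_on UNIV (grad G)"
    and \<phi>: "test_function \<phi>"
  shows "(LINT x|lborel. G x * partial i \<phi> x) = - (LINT x|lborel. grad G x $ i * \<phi> x)"
proof -
  note t = test_function_grad[OF \<phi>]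
  obtain R where R: "\<And>x. R < norm x \<Longrightarrow> \<phi> x = 0" using test_function_support[OF \<phi>] by blast
  have G_cont: "continuous_on UNIV G" and \<phi>_cont: "continuous_on UNIV \<phi>"
    by (intro continuous_at_imp_continuous_on ballI differentiable_imp_continuous_within diff t)+
  have p: "partial i \<phi> x = grad \<phi> x $ i" for x by (simp add: grad_def)
  have int1: "integrable lborel (\<lambda>x. G x * grad \<phi> x $ i)"
    by (rule integrable_cball_continuous[of _ R]) (auto intro!: continuous_intros G_cont t simp: grad_zero_outside[OF R])
  have int2: "integrable lborel (\<lambda>x. grad G x $ i * \<phi> x)"
    by (rule integrable_cball_continuous[of _ R]) (auto intro!: continuous_intros cont \<phi>_cont simp: R)
  have der: "((\<lambda>x. G x * \<phi> x) has_derivative (\<lambda>h. (G x *\<^sub>R grad \<phi> x + \<phi> x *\<^sub>R grad G x) \<bullet> h)) (at x)" for x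
    using has_derivative_mult[OF has_derivative_grad[OF diff] has_derivative_grad[OF t(1)], of x]
    by (simp add: inner_add_left mult.commute)
  have g: "grad (\<lambda>x. G x * \<phi> x) x = G x *\<^sub>R grad \<phi> x + \<phi> x *\<^sub>R grad G x" for x by (rule grad_eqI[OF der])
  have "(LINT x|lborel. grad (\<lambda>x. G x * \<phi> x) x $ i) = 0"
  proof (rule integral_partial_zero[where R = R])
    show "(\<lambda>x. G x * \<phi> x) differentiable (at x)" for x using der by (rule differentiableI)
    show "continuous_on UNIV (grad (\<lambda>x. G x * \<phi> x))"
      unfolding g[abs_def] by (intro continuous_intros G_cont \<phi>_cont cont t)
  qed (simp add: R)
  then have "(LINT x|lborel. G x * grad \<phi> x $ i + grad G x $ i * \<phi> x) = 0" by (simp add: g mult.commute)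
  then show ?thesis using Bochner_Integration.integral_add[OF int1 int2] by (simp add: p)
qed

section \<open>Sobolev regularity of radial powers\<close>

text \<open>One dominating function for a whole family \<open>f_k \<phi>\<close> in which all \<open>f_k\<close> obey the same power bound.\<close>

lemma integrable_majorant_compact_support:
  fixes \<phi> :: "real^'n \<Rightarrow> real"
  assumes s: "-1 < s"
    and \<phi>: "continuous_on UNIV \<phi>" "\<And>x. R < norm x \<Longrightarrow> \<phi> x = 0"
  shows "\<exists>w. integrable lborel w \<and> (\<forall>x y. \<bar>y\<bar> \<le> C * norm x powr s \<longrightarrow> \<bar>y * \<phi> x\<bar> \<le> w x)"
proof -
  have "bounded (\<phi> ` cball 0 R)"
    by (intro compact_imp_bounded compact_continuous_image compact_cball continuous_on_subset[OF \<phi>(1)]) simp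
  then obtain B where B: "\<forall>x\<in>cball 0 R. \<bar>\<phi> x\<bar> \<le> B" by (auto simp: bounded_iff)
  define w where "w x = (\<bar>B\<bar> * \<bar>C\<bar>) * (indicator (cball 0 R) x * norm x powr s)" for x :: "real^'n"
  have "integrable lborel w" unfolding w_def by (intro integrable_mult_right integrable_norm_powr_cball s)
  moreover have "\<bar>y * \<phi> x\<bar> \<le> w x" if "\<bar>y\<bar> \<le> C * norm x powr s" for x y
  proof (cases "norm x \<le> R")
    case True
    have "\<bar>y\<bar> \<le> \<bar>C\<bar> * norm x powr s" using that by (rule order_trans) (simp add: mult_right_mono)
    moreover have "\<bar>\<phi> x\<bar> \<le> \<bar>B\<bar>" using B True by (meson abs_ge_self mem_cball_0 order_trans)
    ultimately have "\<bar>y\<bar> * \<bar>\<phi> x\<bar> \<le> (\<bar>C\<bar> * norm x powr s) * \<bar>B\<bar>"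
      by (intro mult_mono) auto
    then show ?thesis using True by (simp add: w_def abs_mult mult_ac)
  qed (simp add: \<phi>(2) w_def)
  ultimately show ?thesis by blast
qed

text \<open>For negative s the field is not differentiable at the origin, and |x|^2 is replaced by |x|^2 + \<epsilon>.
  Since s is negative, the regularized field and its derivatives are bounded by |x|^(s+1) and by
  (1 + |s|) |x|^s uniformly in \<epsilon>. Both bounds are locally integrable, so integration by parts passes to
  the limit.\<close>

lemma power_field_weak_derivative:
  fixes \<phi> :: "real^'n \<Rightarrow> real"
  assumes s: "-1 < s" "s < 0" and \<phi>: "test_function \<phi>"
  shows "(LINT x|lborel. power_field s x $ j * partial i \<phi> x)
    = - (LINT x|lborel. power_field_jacobian s x $ j $ i * \<phi> x)"
proof -
  note t = test_function_grad[OF \<phi>]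
  obtain R where R: "\<And>x. R < norm x \<Longrightarrow> \<phi> x = 0" using test_function_support[OF \<phi>] by blast
  have \<phi>_cont: "continuous_on UNIV \<phi>" and p_cont: "continuous_on UNIV (partial i \<phi>)"
    by (intro continuous_at_imp_continuous_on ballI differentiable_imp_continuous_within t test_function_grad(1)[OF t(3)])+
  have pR: "partial i \<phi> x = 0" if "R < norm x" for x
    using grad_zero_outside[OF R that] by (simp add: grad_def vec_eq_iff)
  define \<epsilon> :: "nat \<Rightarrow> real" where "\<epsilon> k = inverse (real (Suc k))" for k
  have \<epsilon>: "0 < \<epsilon> k" for k by (simp add: \<epsilon>_def)
  have \<epsilon>0: "\<epsilon> \<longlonglongrightarrow> 0" unfolding \<epsilon>_def by (rule LIMSEQ_inverse_real_of_nat)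
  define q where "q k x = x \<bullet> x + \<epsilon> k" for k and x :: "real^'n"
  have q: "0 < q k x" "x \<bullet> x \<le> q k x" for k x using \<epsilon>[of k] by (auto simp: q_def add_nonneg_pos)
  define G where "G k x = q k x powr (s/2) * x $ j" for k x
  define DG where "DG k x = (s * q k x powr (s/2 - 1) * x $ j) *\<^sub>R x + q k x powr (s/2) *\<^sub>R axis j 1" for k x
  have dG: "(G k has_derivative (\<lambda>h. DG k x \<bullet> h)) (at x)" for k x
  proof -
    have "(q k has_derivative (\<lambda>h. 2 * (x \<bullet> h))) (at x)"
      unfolding q_def[abs_def] by (auto intro!: derivative_eq_intros simp: inner_commute)
    moreover have "((\<lambda>z. z powr (s/2)) has_derivative (*) (s/2 * q k x powr (s/2 - 1))) (at (q k x))"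
      using has_real_derivative_powr[OF q(1), of "s/2"] by (simp add: has_field_derivative_def)
    ultimately have "((\<lambda>x. q k x powr (s/2)) has_derivative (\<lambda>h. s/2 * q k x powr (s/2 - 1) * (2 * (x \<bullet> h)))) (at x)"
      by (rule has_derivative_compose)
    moreover have "((\<lambda>x. x $ j) has_derivative (\<lambda>h. h $ j)) (at x)"
      by (intro bounded_linear_imp_has_derivative bounded_linear_vec_nth)
    ultimately have "(G k has_derivative (\<lambda>h. q k x powr (s/2) * h $ j + s/2 * q k x powr (s/2 - 1) * (2 * (x \<bullet> h)) * x $ j)) (at x)"
      unfolding G_def[abs_def] by (rule has_derivative_mult)
    then show ?thesis
      by (rule has_derivative_eq_rhs) (simp add: DG_def fun_eq_iff inner_add_left inner_axis' algebra_simps)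
  qed
  have gG: "grad (G k) x = DG k x" for k x by (rule grad_eqI[OF dG])
  have q_cont: "continuous_on UNIV (q k)" for k unfolding q_def[abs_def] by (intro continuous_intros)
  have G_cont: "continuous_on UNIV (G k)" for k
    using q(1) unfolding G_def[abs_def] by (intro continuous_intros q_cont) (auto simp: less_imp_neq[symmetric])
  have DG_cont: "continuous_on UNIV (DG k)" for k
    using q(1) unfolding DG_def[abs_def] by (intro continuous_intros q_cont) (auto simp: less_imp_neq[symmetric])
  have parts: "(LINT x|lborel. G k x * partial i \<phi> x) = - (LINT x|lborel. DG k x $ i * \<phi> x)" for k
    unfolding gG[symmetric]
  proof (rule integration_by_parts[OF _ _ \<phi>])
    show "G k differentiable (at x)" for x using dG by (rule differentiableI)
    show "continuous_on UNIV (grad (G k))" using DG_cont by (simp add: gG[abs_def])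
  qed
  have q_le: "q k x powr (s/2) \<le> norm x powr s" if "x \<noteq> 0" for k x
    using that q s by (subst norm_powr_eq) (intro powr_mono2', auto)
  have G_le: "\<bar>G k x\<bar> \<le> 1 * norm x powr (s + 1)" for k x
  proof (cases "x = 0")
    case False
    have "\<bar>G k x\<bar> \<le> norm x powr s * norm x"
      unfolding G_def abs_mult using q_le[OF False] component_le_norm_cart[of x j] by (intro mult_mono) auto
    then show ?thesis using False by (simp add: powr_add)
  qed (simp add: G_def)
  have DG_le: "\<bar>DG k x $ i\<bar> \<le> (1 + \<bar>s\<bar>) * norm x powr s" if x: "x \<noteq> 0" for k x
  proof -
    have "\<bar>x $ j * x $ i\<bar> \<le> norm x * norm x"
      unfolding abs_mult by (intro mult_mono component_le_norm_cart) auto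
    also have "\<dots> \<le> q k x" using q(2)[of x k] by (simp add: power2_norm_eq_inner[symmetric] power2_eq_square)
    finally have "q k x powr (s/2 - 1) * \<bar>x $ j * x $ i\<bar> \<le> q k x powr (s/2 - 1) * q k x"
      by (intro mult_left_mono) auto
    also have "\<dots> = q k x powr (s/2)" using q(1)[of k x] by (simp add: powr_diff)
    also have "\<dots> \<le> norm x powr s" by (rule q_le[OF x])
    finally have "\<bar>s\<bar> * (q k x powr (s/2 - 1) * \<bar>x $ j * x $ i\<bar>) \<le> \<bar>s\<bar> * norm x powr s"
      by (intro mult_left_mono) auto
    then have 1: "\<bar>s * q k x powr (s/2 - 1) * x $ j * x $ i\<bar> \<le> \<bar>s\<bar> * norm x powr s" by (simp add: abs_mult mult_ac)
    have 2: "\<bar>q k x powr (s/2) * axis j 1 $ i\<bar> \<le> norm x powr s" using q_le[OF x, of k] by (simp add: axis_def)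
    have "DG k x $ i = s * q k x powr (s/2 - 1) * x $ j * x $ i + q k x powr (s/2) * axis j 1 $ i" by (simp add: DG_def)
    then have "\<bar>DG k x $ i\<bar> \<le> \<bar>s\<bar> * norm x powr s + norm x powr s"
      using order_trans[OF abs_triangle_ineq add_mono[OF 1 2]] by simp
    then show ?thesis by (simp add: algebra_simps)
  qed
  have q_lim: "(\<lambda>k. q k x powr r) \<longlonglongrightarrow> norm x powr (2 * r)" if "x \<noteq> 0" for x r
  proof -
    have "(\<lambda>k. q k x) \<longlonglongrightarrow> x \<bullet> x + 0" unfolding q_def by (intro tendsto_intros \<epsilon>0)
    then have "(\<lambda>k. q k x powr r) \<longlonglongrightarrow> (x \<bullet> x) powr r" using that by (intro tendsto_powr) auto
    then show ?thesis by (simp add: norm_powr_eq)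
  qed
  \<comment> \<open>For the derivatives, both the bound and the pointwise limit fail at the origin, a null set.\<close>
  have ae: "AE x in lborel. x \<noteq> (0::real^'n)" by (rule AE_lborel_singleton)
  have [measurable]: "G k \<in> borel_measurable borel" "(\<lambda>x. DG k x $ i) \<in> borel_measurable borel"
    "\<phi> \<in> borel_measurable borel" "partial i \<phi> \<in> borel_measurable borel" for k
    by (intro borel_measurable_continuous_onI continuous_intros G_cont DG_cont \<phi>_cont p_cont)+
  have J_cont: "continuous_on (- {0}) (\<lambda>x::real^'n. power_field_jacobian s x $ j $ i)"
    by (intro continuous_intros continuous_on_power_field_jacobian)
  have F_cont: "continuous_on (- {0}) (\<lambda>x::real^'n. power_field s x $ j)"
    unfolding power_field_def by (intro continuous_intros) auto
  have [measurable]: "(\<lambda>x::real^'n. power_field_jacobian s x $ j $ i) \<in> borel_measurable borel"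
    "(\<lambda>x::real^'n. power_field s x $ j) \<in> borel_measurable borel"
    by (intro borel_measurable_off_origin J_cont F_cont)+
  have l1: "(\<lambda>k. LINT x|lborel. G k x * partial i \<phi> x) \<longlonglongrightarrow> (LINT x|lborel. power_field s x $ j * partial i \<phi> x)"
  proof -
    obtain w where w: "integrable lborel w" "\<And>x y. \<bar>y\<bar> \<le> 1 * norm x powr (s + 1) \<Longrightarrow> \<bar>y * partial i \<phi> x\<bar> \<le> w x"
      using integrable_majorant_compact_support[of "s + 1" "partial i \<phi>" R 1] s p_cont pR by auto
    show ?thesis
    proof (rule integral_dominated_convergence[OF _ _ w(1)])
      show "AE x in lborel. (\<lambda>k. G k x * partial i \<phi> x) \<longlonglongrightarrow> power_field s x $ j * partial i \<phi> x"
        using ae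
      proof eventually_elim
        case (elim x)
        show ?case unfolding G_def power_field_def using q_lim[OF elim, of "s/2"]
          by (auto intro!: tendsto_intros)
      qed
      show "AE x in lborel. norm (G k x * partial i \<phi> x) \<le> w x" for k using w(2)[OF G_le] by simp
    qed measurable
  qed
  have l2: "(\<lambda>k. LINT x|lborel. DG k x $ i * \<phi> x) \<longlonglongrightarrow> (LINT x|lborel. power_field_jacobian s x $ j $ i * \<phi> x)"
  proof -
    obtain w where w: "integrable lborel w" "\<And>x y. \<bar>y\<bar> \<le> (1 + \<bar>s\<bar>) * norm x powr s \<Longrightarrow> \<bar>y * \<phi> x\<bar> \<le> w x"
      using integrable_majorant_compact_support[of s \<phi> R "1 + \<bar>s\<bar>"] s \<phi>_cont R by auto
    show ?thesis
    proof (rule integral_dominated_convergence[OF _ _ w(1)])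
      show "AE x in lborel. (\<lambda>k. DG k x $ i * \<phi> x) \<longlonglongrightarrow> power_field_jacobian s x $ j $ i * \<phi> x"
        using ae
      proof eventually_elim
        case (elim x)
        have "(\<lambda>k. DG k x $ i) \<longlonglongrightarrow> s * norm x powr (2 * (s/2 - 1)) * x $ j * x $ i + norm x powr (2 * (s/2)) * axis j 1 $ i"
        proof -
          have "DG k x $ i = s * q k x powr (s/2 - 1) * x $ j * x $ i + q k x powr (s/2) * axis j 1 $ i" for k
            by (simp add: DG_def)
          then show ?thesis by (simp only:) (intro tendsto_add tendsto_mult tendsto_const q_lim[OF elim])
        qed
        also have "s * norm x powr (2 * (s/2 - 1)) * x $ j * x $ i + norm x powr (2 * (s/2)) * axis j 1 $ i
            = power_field_jacobian s x $ j $ i"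
          by (simp add: power_field_jacobian_def axis_def algebra_simps)
        finally show ?case by (rule tendsto_mult[OF _ tendsto_const])
      qed
      show "AE x in lborel. norm (DG k x $ i * \<phi> x) \<le> w x" for k
        using ae by eventually_elim (use w(2)[OF DG_le] in simp)
    qed measurable
  qed
  have "(\<lambda>k. LINT x|lborel. G k x * partial i \<phi> x) \<longlonglongrightarrow> - (LINT x|lborel. power_field_jacobian s x $ j $ i * \<phi> x)"
    unfolding parts by (intro tendsto_minus l2)
  with l1 show ?thesis by (rule LIMSEQ_unique)
qed

lemma LINT_lebesgue_eq_lborel:
  fixes f :: "real^'n \<Rightarrow> real"
  assumes "f \<in> borel_measurable borel"
  shows "(LINT x|lebesgue. f x) = (LINT x|lborel. f x)"
  using assms by (intro integral_completion) simp

text \<open>The function is C^1, so its first weak derivatives are classical. The second ones come from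
  \<open>power_field_weak_derivative\<close>, and the lower bound on (g - 1) \<delta> is what makes |x|^((g-1) \<delta>) locally
  integrable.\<close>

lemma Wloc_radial_power:
  fixes u :: "real^'n \<Rightarrow> real"
  assumes g: "0 < g" "g < 1" and \<delta>: "0 < \<delta>" "-1 < (g - 1) * \<delta>"
    and u: "u = (\<lambda>x. A * norm x powr (g + 1))"
    and du: "\<And>x. (u has_derivative (\<lambda>h. (a *\<^sub>R power_field (g - 1) x) \<bullet> h)) (at x)"
  shows "Wloc 2 \<delta> u"
proof -
  let ?F = "power_field (g - 1) :: real^'n \<Rightarrow> real^'n" and ?J = "power_field_jacobian (g - 1) :: real^'n \<Rightarrow> real^'n^'n"
  have gu: "grad u x = a *\<^sub>R ?F x" for x by (rule grad_eqI[OF du])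
  have u_diff: "u differentiable (at x)" for x using du by (rule differentiableI)
  have u_cont: "continuous_on UNIV u"
    by (intro continuous_at_imp_continuous_on ballI differentiable_imp_continuous_within u_diff)
  have F_off: "continuous_on (- {0}) ?F" unfolding power_field_def[abs_def] by (intro continuous_intros) auto
  have F_cont: "continuous_on UNIV ?F"
  proof (rule continuous_at_imp_continuous_on, rule ballI)
    fix x :: "real^'n"
    show "isCont ?F x"
    proof (cases "x = 0")
      case False
      then show ?thesis using F_off by (simp add: continuous_on_eq_continuous_at open_Compl)
    next
      case True
      have "((\<lambda>x::real^'n. norm x powr g) \<longlongrightarrow> 0 powr g) (at 0)"
        using g by (intro tendsto_intros tendsto_norm_zero) (auto intro!: always_eventually)
      then have "(?F \<longlongrightarrow> 0) (at 0)"
        by (intro Lim_null_comparison[of ?F "\<lambda>x. norm x powr g"]) (auto simp: norm_power_field intro!: always_eventually)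
      then show ?thesis using True by (simp add: isCont_def power_field_def)
    qed
  qed
  have J_off: "continuous_on (- {0}) (\<lambda>x. ?J x $ j $ i)" for i j
    by (intro continuous_intros continuous_on_power_field_jacobian)
  have mu: "u \<in> borel_measurable borel" by (rule borel_measurable_continuous_onI[OF u_cont])
  have mF: "(\<lambda>x. a * ?F x $ i) \<in> borel_measurable borel" for i
    by (intro borel_measurable_continuous_onI continuous_intros F_cont)
  have mJ: "(\<lambda>x. a * ?J x $ j $ i) \<in> borel_measurable borel" for i j
    by (intro borel_measurable_times borel_measurable_const borel_measurable_off_origin J_off)
  have pos: "-1 < r * \<delta>" if "0 \<le> r" for r using that \<delta> by (meson less_le_trans mult_nonneg_nonneg less_imp_le neg_less_0_iff_less zero_less_one)
  have Lu: "Lloc \<delta> u"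
    by (rule Lloc_of_power_bound[OF mu \<delta>(1), of "g + 1" "\<bar>A\<bar>"]) (use g pos in \<open>auto simp: u abs_mult\<close>)
  have LF: "Lloc \<delta> (\<lambda>x. a * ?F x $ i)" for i
  proof (rule Lloc_of_power_bound[OF mF \<delta>(1), where s = g and C = "\<bar>a\<bar>"])
    show "\<bar>a * ?F x $ i\<bar> \<le> \<bar>a\<bar> * norm x powr g" for x
      using power_field_bounds(1)[of "g - 1" x i] by (simp add: abs_mult mult_left_mono)
  qed (use g pos in auto)
  have LJ: "Lloc \<delta> (\<lambda>x. a * ?J x $ j $ i)" for i j
  proof (rule Lloc_of_power_bound[OF mJ \<delta>, where C = "\<bar>a\<bar> * (1 + \<bar>g - 1\<bar>)"])
    show "\<bar>a * ?J x $ j $ i\<bar> \<le> \<bar>a\<bar> * (1 + \<bar>g - 1\<bar>) * norm x powr (g - 1)" for x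
      using power_field_bounds(2)[of "g - 1" x j i] by (simp add: abs_mult mult_left_mono mult.assoc)
  qed
  have w0: "weak_partial [] u u" by (simp add: weak_partial_def)
  have meas\<phi>: "\<phi> \<in> borel_measurable borel" if "test_function \<phi>" for \<phi> :: "real^'n \<Rightarrow> real"
    by (intro borel_measurable_continuous_onI continuous_at_imp_continuous_on ballI
        differentiable_imp_continuous_within test_function_grad(1)[OF that])
  have ibp_u: "(LINT x|lborel. u x * partial i \<phi> x) = - (LINT x|lborel. a * ?F x $ i * \<phi> x)"
    if "test_function \<phi>" for i and \<phi> :: "real^'n \<Rightarrow> real"
  proof -
    have "continuous_on UNIV (grad u)" unfolding gu[abs_def] by (intro continuous_intros F_cont)
    from integration_by_parts[OF u_diff this that, of i] show ?thesis by (simp add: gu)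
  qed
  have w1: "weak_partial [i] u (\<lambda>x. a * ?F x $ i)" for i
    unfolding weak_partial_def
  proof (intro allI impI)
    fix \<phi> :: "real^'n \<Rightarrow> real" assume \<phi>: "test_function \<phi>"
    show "(LINT x|lebesgue. u x * iter_partial [i] \<phi> x) = (-1) ^ length [i] * (LINT x|lebesgue. a * ?F x $ i * \<phi> x)"
      using ibp_u[OF \<phi>] mu mF meas\<phi>[OF \<phi>] meas\<phi>[OF test_function_grad(3)[OF \<phi>]]
      by (simp add: LINT_lebesgue_eq_lborel)
  qed
  have w2: "weak_partial [i, j] u (\<lambda>x. a * ?J x $ i $ j)" for i j
    unfolding weak_partial_def
  proof (intro allI impI)
    fix \<phi> :: "real^'n \<Rightarrow> real" assume \<phi>: "test_function \<phi>"
    note \<phi>j = test_function_grad(3)[OF \<phi>, of j]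
    have "(LINT x|lborel. u x * partial i (partial j \<phi>) x) = - (a * (LINT x|lborel. ?F x $ i * partial j \<phi> x))"
      using ibp_u[OF \<phi>j, of i] by (simp add: mult.assoc)
    also have "\<dots> = (LINT x|lborel. a * ?J x $ i $ j * \<phi> x)"
      using power_field_weak_derivative[of "g - 1" \<phi> i j] g \<phi> by (simp add: mult.assoc)
    finally show "(LINT x|lebesgue. u x * iter_partial [i, j] \<phi> x) = (-1) ^ length [i, j] * (LINT x|lebesgue. a * ?J x $ i $ j * \<phi> x)"
      using mu mJ meas\<phi>[OF \<phi>] meas\<phi>[OF test_function_grad(3)[OF \<phi>j]]
      by (simp add: LINT_lebesgue_eq_lborel)
  qed
  show ?thesis
    unfolding Wloc_def
  proof (intro conjI Lu allI impI)
    fix "is" :: "'n list" assume "length is \<le> 2"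
    then consider "is = []" | i where "is = [i]" | i j where "is = [i, j]"
      by (cases "is"; cases "tl is") auto
    then show "\<exists>h. Lloc \<delta> h \<and> weak_partial is u h"
      by cases (use Lu LF LJ w0 w1 w2 in blast)+
  qed
qed

section \<open>Entire subsolutions exist exactly for constant right-hand sides\<close>

text \<open>In case (I) the exponent g of |Du| is at least 1 and the gradient is C^1. In case (II) g < 1, but the
  exponent g (p - 1) of the field is at least 1, and the bound on \<delta> is equivalent to
  (g - 1) \<delta> > -1.\<close>

lemma subsolution_exists:
  fixes K :: "(real^'n) set" and Q :: "real^'n^'n \<Rightarrow> real"
  assumes KQ: "dominates_least_eigenvalue K Q"
    and p: "1 < p" and \<beta>: "\<beta> < p - 1" and \<alpha>: "-1 < \<alpha>"
    and cases: "p \<le> \<alpha> + \<beta> + 2 \<or> (p > \<alpha> + \<beta> + 2 \<and> (p - 1) * \<alpha> + \<beta> \<ge> 0)"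
    and \<delta>: "p > \<alpha> + \<beta> + 2 \<Longrightarrow> 1 < \<delta> \<and> \<delta> < (p - \<beta> - 1) / (p - \<alpha> - \<beta> - 2)"
  shows "\<exists>u. entire_nontrivial_subsolution K Q p \<alpha> \<beta> \<delta> (\<lambda>t. 1) u"
proof -
  define \<sigma> where "\<sigma> = p - 1 - \<beta>"
  define g where "g = (\<alpha> + 1) / \<sigma>"
  have \<sigma>: "0 < \<sigma>" using \<beta> by (simp add: \<sigma>_def)
  have g: "0 < g" using \<alpha> \<sigma> by (simp add: g_def)
  obtain A where A: "0 < A"
    and adm: "admissible K p (\<lambda>x. A * norm x powr (g + 1))"
    and ge: "satisfies_ge Q p \<alpha> \<beta> (\<lambda>t. 1) (\<lambda>x. A * norm x powr (g + 1))"
    and du: "\<And>x::real^'n. ((\<lambda>x. A * norm x powr (g + 1)) has_derivative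
      (\<lambda>h. ((A * (g + 1)) *\<^sub>R power_field (g - 1) x) \<bullet> h)) (at x)"
    and pf: "p_field p (\<lambda>x::real^'n. A * norm x powr (g + 1)) =
      (\<lambda>x. (A * (g + 1)) powr (p - 1) *\<^sub>R power_field (g * (p - 1) - 1) x)"
    using radial_power_subsolution[OF KQ p \<beta> \<alpha>] unfolding g_def \<sigma>_def by blast
  define u :: "real^'n \<Rightarrow> real" where "u = (\<lambda>x. A * norm x powr (g + 1))"
  have du': "(u has_derivative (\<lambda>h. ((A * (g + 1)) *\<^sub>R power_field (g - 1) x) \<bullet> h)) (at x)" for x
    unfolding u_def by (rule du)
  have gu: "grad u = (\<lambda>x. (A * (g + 1)) *\<^sub>R power_field (g - 1) x)"
    using grad_eqI[OF du'] by (rule ext)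
  have u_diff: "u differentiable (at x)" for x using du' by (rule differentiableI)
  have "regular p \<alpha> \<beta> \<delta> u"
  proof (cases "p \<le> \<alpha> + \<beta> + 2")
    case True
    then have "\<sigma> \<le> \<alpha> + 1" by (simp add: \<sigma>_def)
    then have "1 \<le> g" using \<sigma> by (simp add: g_def)
    then have "C1_field_on UNIV (grad u)" unfolding gu by (intro C1_field_scaleR(1) C1_power_field) simp
    with True u_diff show ?thesis by (simp add: regular_def regular_I_def C2_on_def)
  next
    case False
    then have lt: "\<alpha> + 1 < \<sigma>" by (simp add: \<sigma>_def)
    then have g1: "g < 1" using \<sigma> by (simp add: g_def)
    have "C1_field_on (- {0}) (grad u)"
      unfolding gu by (intro C1_field_scaleR(1) C1_power_field_away(1))
    then have C2: "C2_on (- {0}) u" using u_diff by (simp add: C2_on_def)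
    \<comment> \<open>The hypothesis (p - 1) \<alpha> + \<beta> \<ge> 0 says exactly that the exponent of the field is at least one.\<close>
    have "\<sigma> \<le> (\<alpha> + 1) * (p - 1)" using cases False by (simp add: \<sigma>_def algebra_simps)
    then have "0 \<le> g * (p - 1) - 1" using \<sigma> by (simp add: g_def field_simps)
    then have field: "C1_field_on UNIV (p_field p u)"
      unfolding u_def pf by (intro C1_field_scaleR(1) C1_power_field)
    have "1 < \<delta>" "\<delta> < \<sigma> / (\<sigma> - (\<alpha> + 1))" using \<delta> False by (auto simp: \<sigma>_def algebra_simps)
    then have "-1 < (g - 1) * \<delta>" "0 < \<delta>" using \<sigma> lt by (auto simp: g_def field_simps)
    then have "Wloc 2 \<delta> u" using Wloc_radial_power[OF g g1 _ _ u_def du'] by blast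
    with C2 u_diff field False show ?thesis by (simp add: regular_def regular_II_def)
  qed
  moreover have "\<not> u constant_on UNIV"
  proof
    assume "u constant_on UNIV"
    then obtain y where y: "\<And>x. u x = y" by (auto simp: constant_on_def)
    obtain e :: "real^'n" where "norm e = 1" using vector_choose_size[of 1] by auto
    then show False using y[of 0] y[of e] A by (simp add: u_def)
  qed
  moreover have "admissible K p u" "satisfies_ge Q p \<alpha> \<beta> (\<lambda>t. 1) u"
    unfolding u_def by (rule adm, rule ge)
  ultimately show ?thesis unfolding entire_nontrivial_subsolution_def by blast
qed

lemma no_subsolution:
  fixes u :: "real^'n \<Rightarrow> real"
  assumes p: "1 < p" and \<beta>: "\<beta> < p - 1" and \<alpha>: "-1 < \<alpha>" and c: "0 < c" and C: "0 < C"
    and tr: "\<And>M::real^'n^'n. (\<exists>l. has_eigenvalues M l) \<Longrightarrow> eigenvalues M \<in> K \<Longrightarrow>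
      0 < trace M \<and> Q M \<le> C * trace M"
  shows "\<not> entire_nontrivial_subsolution K Q p \<alpha> \<beta> \<delta> (\<lambda>t. exp (c * t)) u"
proof
  assume "entire_nontrivial_subsolution K Q p \<alpha> \<beta> \<delta> (\<lambda>t. exp (c * t)) u"
  then have reg: "regular p \<alpha> \<beta> \<delta> u" and adm: "admissible K p u"
    and ge: "satisfies_ge Q p \<alpha> \<beta> (\<lambda>t. exp (c * t)) u"
    by (auto simp: entire_nontrivial_subsolution_def)
  have diff: "u differentiable (at x)" "x \<noteq> 0 \<Longrightarrow> grad u differentiable (at x)" for x
    using reg by (auto simp: regular_def regular_I_def regular_II_def C2_on_def C1_field_on_def split: if_splits)
  have "strictly_p_subharmonic p u"
    using adm tr diff by (auto simp: strictly_p_subharmonic_def admissible_def C1_field_on_def)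
  moreover have "norm x powr \<alpha> * rpow (norm (grad u x)) \<beta> * exp (c * u x) \<le> C * trace (D_field p u x)"
    if "x \<noteq> 0" for x
  proof -
    have "norm x powr \<alpha> * rpow (norm (grad u x)) \<beta> * exp (c * u x) \<le> Q (D_field p u x)"
      using ge that by (simp add: satisfies_ge_def)
    also have "\<dots> \<le> C * trace (D_field p u x)" using adm tr that by (simp add: admissible_def)
    finally show ?thesis .
  qed
  ultimately show False by (rule no_entire_exponential_subsolution[OF p \<beta> \<alpha> c C])
qed

theorem corollary6p1:
  fixes k :: nat and p \<alpha> \<beta> \<delta> c :: real and f :: "real \<Rightarrow> real"
  assumes "1 \<le> k" "k \<le> CARD('n::finite)"
    and "p > 1" "\<beta> < p - 1" "\<alpha> > -1"
    and "p \<le> \<alpha> + \<beta> + 2 \<or> (p > \<alpha> + \<beta> + 2 \<and> (p - 1) * \<alpha> + \<beta> \<ge> 0)"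
    and "p > \<alpha> + \<beta> + 2 \<Longrightarrow> 1 < \<delta> \<and> \<delta> < (p - \<beta> - 1) / (p - \<alpha> - \<beta> - 2)"
    and "c \<ge> 0" "f = (\<lambda>t. exp (c * t))"
  shows "((\<exists>u :: real^'n \<Rightarrow> real. entire_nontrivial_subsolution (Gamma_cone k)
            (\<lambda>M. root k (S_mat k M)) p \<alpha> \<beta> \<delta> f u) \<longleftrightarrow> c = 0) \<and>
         ((\<exists>u :: real^'n \<Rightarrow> real. entire_nontrivial_subsolution (P_cone k)
            (\<lambda>M. root (CARD('n) choose k) (Pi_mat k M)) p \<alpha> \<beta> \<delta> f u) \<longleftrightarrow> c = 0)"
proof (cases "c = 0")
  case True
  then have "f = (\<lambda>t. 1)" using assms(9) by simp
  then show ?thesis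
    using subsolution_exists[OF dominates_least_eigenvalue_S[OF assms(1,2)] assms(3-7)]
      subsolution_exists[OF dominates_least_eigenvalue_Pi[OF assms(1,2)] assms(3-7)] True by simp
next
  case False
  then have c: "0 < c" using assms(8) by simp
  obtain C1 where C1: "0 < C1"
    "\<And>M::real^'n^'n. (\<exists>l. has_eigenvalues M l) \<Longrightarrow> eigenvalues M \<in> Gamma_cone k \<Longrightarrow>
      0 < trace M \<and> root k (S_mat k M) \<le> C1 * trace M"
    using root_S_mat_le_trace[OF assms(1,2)] by blast
  obtain C2 where C2: "0 < C2"
    "\<And>M::real^'n^'n. (\<exists>l. has_eigenvalues M l) \<Longrightarrow> eigenvalues M \<in> P_cone k \<Longrightarrow>
      0 < trace M \<and> root (CARD('n) choose k) (Pi_mat k M) \<le> C2 * trace M"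
    using root_Pi_mat_le_trace[OF assms(1,2)] by blast
  show ?thesis
    using no_subsolution[OF assms(3-5) c C1] no_subsolution[OF assms(3-5) c C2] False assms(9) by simp
qed

end
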